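(* Assume that the objective function $F(\cdot)$ is differentiable and that the problem $\min_{\theta\in\mathbb{R}^d}F(\theta)=\frac1m\sum_{i=1}^mf_i(\theta)$ has an optimal solution. Suppose that a distributed algorithm generates (random) sequences $\{x_i^k\}\subseteq\mathbb{R}^d$ and $\{y_i^k\}\subseteq\mathbb{R}^d$, $i\in[m]$, under coupling matrices $R$ and $C$, respectively, such that the following relation holds almost surely for some sufficiently large integer $T\ge0$ and for all $k\ge T$: $$\mathbb{E}[\mathbf{v}^{k+1}\mid\mathcal{F}^k]\le(V^k+a^k\mathbf{1}\mathbf{1}^T)\mathbf{v}^k+b^k\mathbf{1}-H^k\begin{bmatrix}\|\nabla F(\bar x^k)\|^2\\ \|\bar y^k\|^2\end{bmatrix},$$ where $\mathcal{F}^k=\{x_i^\ell,y_i^\ell;0\le\ell\le k,\ i\in[m]\}$ and $$\mathbf{v}^k=\begin{bmatrix}F(\bar x^k)-F^*\\ \|\mathbf{x}^k-\bar{\mathbf{x}}^k\|_R^2\\ \|\mathbf{y}^k-{\rm diag}(v)\bar{\mathbf{y}}^k\|_C^2\end{bmatrix},\quad V^k=\begin{bmatrix}1&\kappa_1\lambda^k&\kappa_2\lambda^k\\0&1-\kappa_3\gamma_1^k&0\\0&0&1-\kappa_4\gamma_2^k\end{bmatrix},\quad H^k=\begin{bmatrix}\kappa_5\lambda^k&\kappa_6\lambda^k-\kappa_7(\lambda^k)^2\\0&-\kappa_8\frac{(\lambda^k)^2}{\gamma_1^k}\\0&-\kappa_9\frac{(\lambda^k)^2}{\gamma_2^k}\end{bmatrix}$$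 with $\kappa_i>0$ for all $1\le i\le9$ and $\kappa_3,\kappa_4\in(0,1)$, while the nonnegative scalar sequences $\{a^k\},\{b^k\}$ and positive sequences $\{\lambda^k\},\{\gamma_1^k\},\{\gamma_2^k\}$ satisfy $\sum_{k=0}^\infty a^k<\infty$ almost surely, $\sum_{k=0}^\infty b^k<\infty$ almost surely, $\sum_{k=0}^\infty\lambda^k=\infty$, $\sum_{k=0}^\infty\gamma_\imath^k=\infty$, $\sum_{k=0}^\infty(\gamma_\imath^k)^2<\infty$, $\sum_{k=0}^\infty\frac{(\lambda^k)^2}{\gamma_\imath^k}<\infty$, $\lim_{k\to\infty}\lambda^k/\gamma_\imath^k=0$ for $\imath\in\{1,2\}$, and $\lim_{k\to\infty}\gamma_1^k/\gamma_2^k<\infty$. Then: (a) $\lim_{k\to\infty}F(\bar x^k)$ exists almost surely, and almost surely $\lim_{k\to\infty}\|x_i^k-\bar x^k\|=\lim_{k\to\infty}\|y_i^k-v_i\bar y^k\|=0$ for all $i$. (b) $\liminf_{k\to\infty}\|\nabla F(\bar x^k)\|=0$ holds almost surely. Moreover, if the function $F(\cdot)$ has bounded level sets, then almost surely $\{\bar x^k\}$ is bounded and every accumulation point of $\{\bar x^k\}$ is an optimal solution, and $\lim_{k\to\infty}F(x_i^k)=F^*$ almost surely for all $i\in[m]$.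
   Context: $[m]=\{1,\dots,m\}$; vector inequalities are entrywise; $\mathbf{1}$ is the all-ones vector; $F^*=\min_{\theta\in\mathbb{R}^d}F(\theta)$. Standing assumption on the objective functions: $F$ is convex, and each $f_i:\mathbb{R}^d\to\mathbb{R}$ is differentiable with Lipschitz continuous gradient, i.e. for some $L>0$, $\|\nabla f_i(w)-\nabla f_i(z)\|\le L\|w-z\|$ for all $i\in[m]$, $w,z\in\mathbb{R}^d$. Coupling matrices: $R,C\in\mathbb{R}^{m\times m}$ have nonnegative off-diagonal entries, $R$ has zero row sums and $C$ has zero column sums. For a matrix $A$, $\mathcal{G}_A$ is the directed graph on $[m]$ with an edge from $j$ to $i$ ($i\ne j$) iff $A_{ij}>0$. It is assumed that $\mathcal{G}_R$ and $\mathcal{G}_{C^T}$ each contain at least one spanning tree and that at least one node is a root of spanning trees for both. The vector $u\in\mathbb{R}^m$ is the unique nonnegative vector with $u^TR=0$, $u^T\mathbf{1}=m$; the vector $v\in\mathbb{R}^m$ is the unique nonnegative vector with $Cv=0$, $\mathbf{1}^Tv=m$. $\bar x^k=\frac1m\sum_{i=1}^mu_ix_i^k$, $\bar y^k=\frac1m\sum_{i=1}^my_i^k$; $\mathbf{x}^k=[x_1^k,\dots,x_m^k]^T$, $\mathbf{y}^k=[y_1^k,\dots,y_m^k]^T$, $\bar{\mathbf{x}}^k=[\bar x^k,\dots,\bar x^k]^T$, $\bar{\mathbf{y}}^k=[\bar y^k,\dots,\bar y^k]^T$, all in $\mathbb{R}^{m\times d}$; ${\rm diag}(v)={\rm diag}(v_1,\dots,v_m)$.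 Norms: $\|x\|_R=\|\tilde Rx\|_2$ and $\|x\|_C=\|\tilde Cx\|_2$ are vector norms on $\mathbb{R}^m$, where $\tilde R$, $\tilde C$ are fixed (nonsingular) matrices determined by $R$ and $C$, chosen so that the induced matrix norms satisfy $\|I+\gamma_1^kR-\frac{\mathbf{1}u^T}{m}\|_R<1$ and $\|(1-\alpha^k)(I-\frac{v\mathbf{1}^T}{m})+\gamma_2^kC\|_C<1$ (arbitrarily close to the respective spectral radii), where $\alpha^k$ denotes the additional stepsize parameter of the gradient-tracking algorithm. For $\mathbf{z}\in\mathbb{R}^{m\times d}$ with columns $\mathbf{z}_{(1)},\dots,\mathbf{z}_{(d)}$, $\|\mathbf{z}\|_R=\big\|[\|\mathbf{z}_{(1)}\|_R,\dots,\|\mathbf{z}_{(d)}\|_R]\big\|_2$ and $\|\mathbf{z}\|_C=\big\|[\|\mathbf{z}_{(1)}\|_C,\dots,\|\mathbf{z}_{(d)}\|_C]\big\|_2$. *)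

theory Defs
  imports "HOL-Probability.Probability"
begin

(* THE is legitimate: GDERIV f x :> g determines g, and the operator is used
   only at points of differentiability. *)
definition grad :: "('a::real_inner \<Rightarrow> real) \<Rightarrow> 'a \<Rightarrow> 'a" where
  "grad f x = (THE g. GDERIV f x :> g)"

definition outer :: "real^'n \<Rightarrow> real^'p \<Rightarrow> real^'p^'n" where
  "outer a b = (\<chi> i j. a $ i * b $ j)"

definition diag :: "real^'n \<Rightarrow> real^'n^'n" where
  "diag a = (\<chi> i j. if i = j then a $ i else 0)"

definition rows_of :: "real^'d \<Rightarrow> real^'d^'m" where
  "rows_of c = (\<chi> i. c)"

(* the pair (j, i) is the edge from j to i *)
definition digraph :: "real^'m^'m \<Rightarrow> ('m \<times> 'm) set" where
  "digraph A = {(j, i). i \<noteq> j \<and> A $ i $ j > 0}"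

(* S is a directed tree with root r, contained in E and covering all vertices:
   every vertex except r has exactly one parent, and r is connected to all
   vertices. *)
definition spanning_tree :: "('m \<times> 'm) set \<Rightarrow> 'm \<Rightarrow> ('m \<times> 'm) set \<Rightarrow> bool" where
  "spanning_tree E r S \<longleftrightarrow> S \<subseteq> E \<and> (\<forall>j. (j, r) \<notin> S) \<and>
     (\<forall>i. i \<noteq> r \<longrightarrow> (\<exists>!j. (j, i) \<in> S)) \<and> (\<forall>i. (r, i) \<in> S\<^sup>*)"

definition weighted_avg :: "real^'m \<Rightarrow> real^'d^'m \<Rightarrow> real^'d" where
  "weighted_avg u X = (1 / real CARD('m)) *\<^sub>R (\<Sum>i\<in>UNIV. u $ i *\<^sub>R X $ i)"

definition avg :: "real^'d^'m \<Rightarrow> real^'d" where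
  "avg Y = (1 / real CARD('m)) *\<^sub>R (\<Sum>i\<in>UNIV. Y $ i)"

definition wnorm :: "real^'m^'m \<Rightarrow> real^'m \<Rightarrow> real" where
  "wnorm W a = norm (W *v a)"

(* For invertible W the supremum is over a bounded set; the term for a = 0 is 0. *)
definition induced_norm :: "real^'m^'m \<Rightarrow> real^'m^'m \<Rightarrow> real" where
  "induced_norm W A = (SUP a. wnorm W (A *v a) / wnorm W a)"

definition mnorm :: "real^'m^'m \<Rightarrow> real^'d^'m \<Rightarrow> real" where
  "mnorm W Z = norm ((\<chi> j. wnorm W (column j Z)) :: real^'d)"

definition history ::
  "'w measure \<Rightarrow> (nat \<Rightarrow> 'w \<Rightarrow> real^'d^'m) \<Rightarrow> (nat \<Rightarrow> 'w \<Rightarrow> real^'d^'m) \<Rightarrow> nat \<Rightarrow> 'w measure" where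
  "history M x y k = sigma (space M)
     ({(\<lambda>\<omega>. x l \<omega> $ i) -` A \<inter> space M | l i A. l \<le> k \<and> A \<in> sets borel} \<union>
      {(\<lambda>\<omega>. y l \<omega> $ i) -` A \<inter> space M | l i A. l \<le> k \<and> A \<in> sets borel})"

(* The infimum is the minimum of F whenever a minimiser exists. *)
definition error_vec ::
  "(real^'d \<Rightarrow> real) \<Rightarrow> real^'m \<Rightarrow> real^'m \<Rightarrow> real^'m^'m \<Rightarrow> real^'m^'m \<Rightarrow>
   real^'d^'m \<Rightarrow> real^'d^'m \<Rightarrow> real^3" where
  "error_vec F u v RW CW X Y = vector
     [F (weighted_avg u X) - (INF \<theta>. F \<theta>),
      (mnorm RW (X - rows_of (weighted_avg u X)))\<^sup>2,
      (mnorm CW (Y - diag v ** rows_of (avg Y)))\<^sup>2]"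

definition V_mat :: "(nat \<Rightarrow> real) \<Rightarrow> real \<Rightarrow> real \<Rightarrow> real \<Rightarrow> real^3^3" where
  "V_mat \<kappa> l g1 g2 = vector
     [vector [1, \<kappa> 1 * l, \<kappa> 2 * l],
      vector [0, 1 - \<kappa> 3 * g1, 0],
      vector [0, 0, 1 - \<kappa> 4 * g2]]"

definition H_mat :: "(nat \<Rightarrow> real) \<Rightarrow> real \<Rightarrow> real \<Rightarrow> real \<Rightarrow> real^2^3" where
  "H_mat \<kappa> l g1 g2 = vector
     [vector [\<kappa> 5 * l, \<kappa> 6 * l - \<kappa> 7 * l\<^sup>2],
      vector [0, - (\<kappa> 8 * (l\<^sup>2 / g1))],
      vector [0, - (\<kappa> 9 * (l\<^sup>2 / g2))]]"

end

theory Submission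
  imports Defs
begin

text \<open>Once \<open>\<lambda>\<^sup>k\<close> is small enough relative to \<open>\<gamma>\<^sub>1\<^sup>k\<close> and \<open>\<gamma>\<^sub>2\<^sup>k\<close>, summing the three rows of the relation
  absorbs the coupling terms and leaves
  \<open>E[S\<^sup>k\<^sup>+\<^sup>1 | F\<^sup>k] \<le> (1 + 3a\<^sup>k) S\<^sup>k + 3b\<^sup>k - \<kappa>\<^sub>5 \<lambda>\<^sup>k |\<nabla>F|\<^sup>2 - (\<kappa>\<^sub>6/2) \<lambda>\<^sup>k |y|\<^sup>2\<close> for the sum \<open>S\<close> of the three
  errors, so the Robbins--Siegmund theorem makes \<open>S\<close> converge and both subtracted series summable.
  The perturbations in the second and third rows are then summable, and Robbins--Siegmund applied
  to each of these rows drives the two consensus errors to zero because the \<open>\<gamma>\<close> series diverge. Part (b)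
  follows from divergence of the \<open>\<lambda>\<close> series, convexity, and continuity of the gradient.

  Robbins--Siegmund itself reduces, after discounting by \<open>\<Prod>(1 + c\<^sup>l)\<close>, to almost sure convergence
  of nonnegative supermartingales, which comes from Doob's upcrossing inequality.\<close>

section \<open>Convergence of nonnegative supermartingales\<close>

text \<open>If the limit inferior were below the limit superior, two rationals would fit strictly
  between them and the sequence would visit both sides infinitely often. Rational levels suffice,
  which later keeps the family of exceptional null sets countable.\<close>

lemma convergent_if_no_oscillation:
  fixes u :: "nat \<Rightarrow> real"
  assumes nonneg: "\<And>n. 0 \<le> u n"
    and not_top: "\<not> filterlim u at_top sequentially"
    and no_osc: "\<And>p q. p \<in> \<rat> \<Longrightarrow> q \<in> \<rat> \<Longrightarrow> p < q \<Longrightarrow>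
      \<not> ((\<exists>\<^sub>F n in sequentially. u n \<le> p) \<and> (\<exists>\<^sub>F n in sequentially. q \<le> u n))"
  shows "convergent u"
proof -
  let ?U = "\<lambda>n. ereal (u n)"
  have "limsup ?U \<le> liminf ?U"
  proof (rule ccontr)
    assume "\<not> ?thesis"
    then have "liminf ?U < limsup ?U" by simp
    then obtain q where q: "liminf ?U < ereal (of_rat q)" "ereal (of_rat q) < limsup ?U"
      using ereal_dense3 by blast
    then obtain p where p: "liminf ?U < ereal (of_rat p)" "ereal (of_rat p) < ereal (of_rat q)"
      using ereal_dense3 by blast
    have "\<exists>\<^sub>F n in sequentially. u n \<le> of_rat p"
    proof (rule ccontr)
      assume "\<not> ?thesis"
      then have "\<forall>\<^sub>F n in sequentially. ereal (of_rat p) \<le> ?U n"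
        unfolding not_frequently by eventually_elim auto
      then have "ereal (of_rat p) \<le> liminf ?U" by (rule Liminf_bounded)
      with p show False by simp
    qed
    moreover have "\<exists>\<^sub>F n in sequentially. of_rat q \<le> u n"
    proof (rule ccontr)
      assume "\<not> ?thesis"
      then have "\<forall>\<^sub>F n in sequentially. ?U n \<le> ereal (of_rat q)"
        unfolding not_frequently by eventually_elim auto
      then have "limsup ?U \<le> ereal (of_rat q)" by (rule Limsup_bounded)
      with q show False by simp
    qed
    ultimately show False using no_osc[of "of_rat p" "of_rat q"] p by auto
  qed
  then have eq: "limsup ?U = liminf ?U"
    by (simp add: Liminf_le_Limsup order_antisym)
  \<comment> \<open>In \<open>ereal\<close> the common limit may still be infinite;
    \<open>not_top\<close> excludes this, and nonnegativity excludes the other end.\<close>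
  have "liminf ?U \<noteq> \<infinity>"
  proof
    assume "liminf ?U = \<infinity>"
    then have "?U \<longlonglongrightarrow> \<infinity>" by (simp add: liminf_PInfty)
    then have "filterlim u at_top sequentially"
      by (simp add: tendsto_PInfty_eq_at_top)
    with not_top show False by simp
  qed
  moreover have "0 \<le> liminf ?U" by (rule Liminf_bounded) (simp add: nonneg)
  ultimately obtain L where L: "liminf ?U = ereal L"
    by (cases "liminf ?U") auto
  have "u \<longlonglongrightarrow> L" by (rule limsup_le_liminf_real) (use eq L in auto)
  then show ?thesis by (rule convergentI)
qed

text \<open>Path by path, one unit is bought when the path is at most \<open>p\<close> and sold as soon as it
  is at least \<open>q\<close>.\<close>

primrec holding :: "real \<Rightarrow> real \<Rightarrow> (nat \<Rightarrow> real) \<Rightarrow> nat \<Rightarrow> bool" where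
  "holding p q u 0 \<longleftrightarrow> u 0 \<le> p"
| "holding p q u (Suc n) \<longleftrightarrow> (if holding p q u n then u (Suc n) < q else u (Suc n) \<le> p)"

primrec upcrossings :: "real \<Rightarrow> real \<Rightarrow> (nat \<Rightarrow> real) \<Rightarrow> nat \<Rightarrow> nat" where
  "upcrossings p q u 0 = 0"
| "upcrossings p q u (Suc n) =
     upcrossings p q u n + (if holding p q u n \<and> q \<le> u (Suc n) then 1 else 0)"

lemma incseq_upcrossings: "incseq (upcrossings p q u)"
  by (rule incseq_SucI) simp

lemma holding_if_le:
  assumes "p < q" "u n \<le> p"
  shows "holding p q u n"
  using assms by (cases n) auto

lemma not_holding_if_ge:
  assumes "p < q" "q \<le> u n"
  shows "\<not> holding p q u n"
  using assms by (cases n) auto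

text \<open>A unit held at time \<open>m\<close> and no longer held at time \<open>n\<close> was
  sold in between, and every sale increments the counter.\<close>

lemma upcrossings_less:
  assumes "holding p q u m" "\<not> holding p q u n" "m \<le> n"
  shows "upcrossings p q u m < upcrossings p q u n"
  using assms(3,2)
proof (induction n rule: dec_induct)
  case base
  then show ?case using assms(1) by simp
next
  case (step n)
  have mn: "upcrossings p q u m \<le> upcrossings p q u n"
    using incseq_upcrossings step.hyps(1) by (auto simp: incseq_def)
  show ?case
  proof (cases "holding p q u n")
    case True
    with step.prems mn show ?thesis by (auto split: if_splits)
  next
    case False
    then show ?thesis using step.IH by simp
  qed
qed

text \<open>From any time on, the path falls to \<open>p\<close> and later rises to
  \<open>q\<close>, which adds at least one more sale.\<close>

lemma upcrossings_unbounded: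
  assumes "p < q" "\<exists>\<^sub>F n in sequentially. u n \<le> p" "\<exists>\<^sub>F n in sequentially. q \<le> u n"
  shows "\<exists>n. N \<le> upcrossings p q u n"
proof (induction N)
  case (Suc N)
  then obtain n where n: "N \<le> upcrossings p q u n" by blast
  obtain m where m: "n \<le> m" "u m \<le> p"
    using assms(2) by (auto simp: frequently_sequentially)
  obtain k where k: "m \<le> k" "q \<le> u k"
    using assms(3) by (auto simp: frequently_sequentially)
  have "upcrossings p q u n \<le> upcrossings p q u m"
    using incseq_upcrossings m(1) by (auto simp: incseq_def)
  also have "\<dots> < upcrossings p q u k"
    using holding_if_le[of p q u m] not_holding_if_ge[of p q u k] assms(1) m(2) k
    by (intro upcrossings_less) auto
  finally show ?case using n by (intro exI[of _ k]) simp
qed simp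

section \<open>Filtered probability spaces, upcrossings and almost sure convergence\<close>

locale filtered_prob_space = prob_space M for M :: "'a measure" +
  fixes G :: "nat \<Rightarrow> 'a measure"
  assumes subalg: "subalgebra M (G n)"
    and sets_mono: "m \<le> n \<Longrightarrow> sets (G m) \<subseteq> sets (G n)"
begin

lemma space_G [simp]: "space (G n) = space M"
  using subalg[of n] by (simp add: subalgebra_def)

lemma measurable_G_mono:
  assumes "f \<in> measurable (G m) N" "m \<le> n"
  shows "f \<in> measurable (G n) N"
  using assms sets_mono[OF assms(2)] by (auto simp: measurable_def)

lemma measurable_G:
  assumes "f \<in> measurable (G m) N"
  shows "f \<in> measurable M N"
  using measurable_from_subalg[OF subalg] assms .

lemma sigma_finite_subalgebra_G: "sigma_finite_subalgebra M (G n)"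
proof -
  interpret finite_measure_subalgebra M "G n" by standard (rule subalg)
  show ?thesis by (rule sigma_finite_subalgebra_axioms)
qed

text \<open>The supermartingale property, tested against nonnegative functions, makes sense without
  integrability of the process.\<close>

definition nonneg_supermartingale :: "(nat \<Rightarrow> 'a \<Rightarrow> real) \<Rightarrow> bool" where
  "nonneg_supermartingale U \<longleftrightarrow>
     (\<forall>n. U n \<in> borel_measurable (G n)) \<and> (\<forall>n \<omega>. 0 \<le> U n \<omega>) \<and>
     (\<forall>n g. g \<in> borel_measurable (G n) \<longrightarrow>
        (\<integral>\<^sup>+\<omega>. g \<omega> * ennreal (U (Suc n) \<omega>) \<partial>M) \<le> (\<integral>\<^sup>+\<omega>. g \<omega> * ennreal (U n \<omega>) \<partial>M))"

context
  fixes U :: "nat \<Rightarrow> 'a \<Rightarrow> real"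
  assumes U: "nonneg_supermartingale U"
begin

lemma supermartingale_adapted: "U n \<in> borel_measurable (G n)"
  using U by (simp add: nonneg_supermartingale_def)

lemma supermartingale_nonneg: "0 \<le> U n \<omega>"
  using U by (simp add: nonneg_supermartingale_def)

lemma supermartingale_le:
  "g \<in> borel_measurable (G n) \<Longrightarrow>
     (\<integral>\<^sup>+\<omega>. g \<omega> * ennreal (U (Suc n) \<omega>) \<partial>M) \<le> (\<integral>\<^sup>+\<omega>. g \<omega> * ennreal (U n \<omega>) \<partial>M)"
  using U by (simp add: nonneg_supermartingale_def)

lemma measurable_holding:
  "Measurable.pred (G n) (\<lambda>\<omega>. holding p q (\<lambda>k. U k \<omega>) n)"
proof (induction n)
  case 0
  have [measurable]: "U 0 \<in> borel_measurable (G 0)" by (rule supermartingale_adapted)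
  show ?case by simp
next
  case (Suc n)
  have [measurable]: "U (Suc n) \<in> borel_measurable (G (Suc n))" by (rule supermartingale_adapted)
  have [measurable]: "Measurable.pred (G (Suc n)) (\<lambda>\<omega>. holding p q (\<lambda>k. U k \<omega>) n)"
    using Suc by (rule measurable_G_mono) simp
  show ?case by simp
qed

lemma measurable_upcrossings:
  "(\<lambda>\<omega>. upcrossings p q (\<lambda>k. U k \<omega>) n) \<in> measurable (G n) (count_space UNIV)"
proof (induction n)
  case (Suc n)
  have [measurable]: "U (Suc n) \<in> borel_measurable (G (Suc n))" by (rule supermartingale_adapted)
  have [measurable]: "Measurable.pred (G (Suc n)) (\<lambda>\<omega>. holding p q (\<lambda>k. U k \<omega>) n)"
    using measurable_holding by (rule measurable_G_mono) simp
  have [measurable]: "(\<lambda>\<omega>. upcrossings p q (\<lambda>k. U k \<omega>) n) \<in> measurable (G (Suc n)) (count_space UNIV)"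
    using Suc by (rule measurable_G_mono) simp
  show ?case by simp
qed simp

text \<open>The wealth of the trader starting with cash \<open>p\<close> is a supermartingale and at least
  \<open>q - p\<close> times the number of completed upcrossings.\<close>

lemma upcrossing_inequality:
  assumes "0 \<le> p" "p < q"
  shows "(\<integral>\<^sup>+\<omega>. ennreal (real (upcrossings p q (\<lambda>k. U k \<omega>) n) * (q - p)) \<partial>M) \<le> ennreal p"
proof -
  \<comment> \<open>\<open>K\<close> is the cash and \<open>h\<close> the number of units held. Each
    purchase is booked at exactly \<open>p\<close> and each sale at exactly \<open>q\<close>, so a
    completed round trip leaves \<open>q - p\<close>.\<close>
  define K where "K n \<omega> = real (upcrossings p q (\<lambda>k. U k \<omega>) n) * (q - p) +
    (if holding p q (\<lambda>k. U k \<omega>) n then 0 else p)" for n \<omega>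
  define h where "h n \<omega> = (if holding p q (\<lambda>k. U k \<omega>) n then 1 else 0 :: ennreal)" for n \<omega>
  have h_meas: "h n \<in> borel_measurable (G n)" for n
    unfolding h_def using measurable_holding[of p q n] by measurable
  have K_meas: "K n \<in> borel_measurable (G n)" for n
    unfolding K_def using measurable_holding[of p q n] measurable_upcrossings[of p q n]
    by measurable
  have [measurable]: "h n \<in> borel_measurable M" "K n \<in> borel_measurable M"
      "U n \<in> borel_measurable M" for n
    using h_meas K_meas supermartingale_adapted by (auto intro: measurable_G)
  have K_nonneg: "0 \<le> K n \<omega>" for n \<omega> using assms by (simp add: K_def)
  \<comment> \<open>At the new price, a buyer pays \<open>p\<close> for something worth at most
    \<open>p\<close>, and a seller takes \<open>q\<close> for something worth at least
    \<open>q\<close>. Trading therefore never increases the recorded wealth.\<close>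
  have rebalance: "ennreal (K (Suc n) \<omega>) + h (Suc n) \<omega> * ennreal (U (Suc n) \<omega>)
      \<le> ennreal (K n \<omega>) + h n \<omega> * ennreal (U (Suc n) \<omega>)" for n \<omega>
  proof -
    have nonneg: "0 \<le> U (Suc n) \<omega>" by (rule supermartingale_nonneg)
    define r where "r n = (if holding p q (\<lambda>k. U k \<omega>) n then 1 else 0 :: real)" for n
    have "K (Suc n) \<omega> + r (Suc n) * U (Suc n) \<omega> \<le> K n \<omega> + r n * U (Suc n) \<omega>"
      using assms nonneg unfolding K_def r_def by (auto simp: algebra_simps)
    then have "ennreal (K (Suc n) \<omega> + r (Suc n) * U (Suc n) \<omega>) \<le> ennreal (K n \<omega> + r n * U (Suc n) \<omega>)"
      by (rule ennreal_leI)
    moreover have "h n \<omega> = ennreal (r n)" "0 \<le> r n" for n by (auto simp: h_def r_def)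
    ultimately show ?thesis using nonneg K_nonneg by (simp add: ennreal_mult)
  qed
  have wealth: "(\<integral>\<^sup>+\<omega>. ennreal (K n \<omega>) + h n \<omega> * ennreal (U n \<omega>) \<partial>M) \<le> ennreal p"
  proof (induction n)
    case 0
    have "ennreal (K 0 \<omega>) + h 0 \<omega> * ennreal (U 0 \<omega>) \<le> ennreal p" for \<omega>
      by (auto simp: K_def h_def ennreal_leI)
    then have "(\<integral>\<^sup>+\<omega>. ennreal (K 0 \<omega>) + h 0 \<omega> * ennreal (U 0 \<omega>) \<partial>M) \<le> (\<integral>\<^sup>+\<omega>. ennreal p \<partial>M)"
      by (intro nn_integral_mono) auto
    then show ?case by (simp add: emeasure_space_1)
  next
    case (Suc n)
    have "(\<integral>\<^sup>+\<omega>. ennreal (K (Suc n) \<omega>) + h (Suc n) \<omega> * ennreal (U (Suc n) \<omega>) \<partial>M)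
        \<le> (\<integral>\<^sup>+\<omega>. ennreal (K n \<omega>) + h n \<omega> * ennreal (U (Suc n) \<omega>) \<partial>M)"
      by (intro nn_integral_mono rebalance)
    also have "\<dots> = (\<integral>\<^sup>+\<omega>. ennreal (K n \<omega>) \<partial>M) + (\<integral>\<^sup>+\<omega>. h n \<omega> * ennreal (U (Suc n) \<omega>) \<partial>M)"
      by (intro nn_integral_add) auto
    \<comment> \<open>The position \<open>h n\<close> is known at time \<open>n\<close>, so it is an
      admissible test function for the supermartingale property.\<close>
    also have "\<dots> \<le> (\<integral>\<^sup>+\<omega>. ennreal (K n \<omega>) \<partial>M) + (\<integral>\<^sup>+\<omega>. h n \<omega> * ennreal (U n \<omega>) \<partial>M)"
      by (intro add_left_mono supermartingale_le h_meas)
    also have "\<dots> = (\<integral>\<^sup>+\<omega>. ennreal (K n \<omega>) + h n \<omega> * ennreal (U n \<omega>) \<partial>M)"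
      by (intro nn_integral_add[symmetric]) auto
    also note Suc
    finally show ?case .
  qed
  have "ennreal (real (upcrossings p q (\<lambda>k. U k \<omega>) n) * (q - p))
      \<le> ennreal (K n \<omega>) + h n \<omega> * ennreal (U n \<omega>)" for \<omega>
    using assms by (intro order_trans[OF _ add_increasing2[OF _ order_refl]] ennreal_leI)
      (auto simp: K_def)
  then have "(\<integral>\<^sup>+\<omega>. ennreal (real (upcrossings p q (\<lambda>k. U k \<omega>) n) * (q - p)) \<partial>M)
      \<le> (\<integral>\<^sup>+\<omega>. ennreal (K n \<omega>) + h n \<omega> * ennreal (U n \<omega>) \<partial>M)"
    by (intro nn_integral_mono)
  also note wealth
  finally show ?thesis .
qed

text \<open>The upcrossing bound does not depend on \<open>n\<close>, so by monotone convergence the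
  total number of upcrossings is almost surely finite, whereas an oscillating path has infinitely
  many.\<close>

lemma AE_no_oscillation:
  assumes "p < q"
  shows "AE \<omega> in M. \<not> ((\<exists>\<^sub>F n in sequentially. U n \<omega> \<le> p) \<and> (\<exists>\<^sub>F n in sequentially. q \<le> U n \<omega>))"
proof (cases "0 \<le> p")
  case False
  then have "\<not> U n \<omega> \<le> p" for n \<omega> using supermartingale_nonneg[of n \<omega>] by simp
  then show ?thesis by simp
next
  case True
  define J where "J n \<omega> = ennreal (real (upcrossings p q (\<lambda>k. U k \<omega>) n) * (q - p))" for n \<omega>
  have [measurable]: "(\<lambda>\<omega>. upcrossings p q (\<lambda>k. U k \<omega>) n) \<in> measurable M (count_space UNIV)" for n
    by (rule measurable_G measurable_upcrossings)+
  have J_meas [measurable]: "J n \<in> borel_measurable M" for n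
    unfolding J_def by measurable
  have "incseq (\<lambda>n. J n \<omega>)" for \<omega>
    unfolding J_def using incseq_upcrossings[of p q "\<lambda>k. U k \<omega>"] assms
    by (auto simp: incseq_def intro!: ennreal_leI mult_right_mono)
  then have "incseq J" by (auto simp: incseq_def le_fun_def)
  then have "(\<integral>\<^sup>+\<omega>. (SUP n. J n \<omega>) \<partial>M) = (SUP n. integral\<^sup>N M (J n))"
    by (rule nn_integral_monotone_convergence_SUP) simp
  also have "\<dots> \<le> ennreal p"
    unfolding J_def using upcrossing_inequality[OF True assms] by (intro SUP_least)
  finally have "(\<integral>\<^sup>+\<omega>. (SUP n. J n \<omega>) \<partial>M) \<noteq> \<infinity>"
    by (metis ennreal_neq_top infinity_ennreal_def top.extremum_uniqueI)
  then have "AE \<omega> in M. (SUP n. J n \<omega>) \<noteq> \<infinity>"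
    by (intro nn_integral_noteq_infinite) auto
  then show ?thesis
  proof eventually_elim
    case (elim \<omega>)
    show ?case
    proof
      assume freq: "(\<exists>\<^sub>F n in sequentially. U n \<omega> \<le> p) \<and> (\<exists>\<^sub>F n in sequentially. q \<le> U n \<omega>)"
      obtain B where B: "(SUP n. J n \<omega>) = ennreal B" "0 \<le> B"
        using elim by (cases "SUP n. J n \<omega>") auto
      obtain N :: nat where N: "B / (q - p) < real N" using reals_Archimedean2 by blast
      obtain n where n: "N \<le> upcrossings p q (\<lambda>k. U k \<omega>) n"
        using upcrossings_unbounded[of p q "\<lambda>k. U k \<omega>" N] assms freq by blast
      have "J n \<omega> \<le> ennreal B" unfolding B(1)[symmetric] by (rule SUP_upper) simp
      then have "real (upcrossings p q (\<lambda>k. U k \<omega>) n) * (q - p) \<le> B"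
        using B(2) by (simp add: J_def)
      moreover have "B < real N * (q - p)" using N assms by (simp add: divide_less_eq)
      moreover have "real N * (q - p) \<le> real (upcrossings p q (\<lambda>k. U k \<omega>) n) * (q - p)"
        using n assms by (intro mult_right_mono) auto
      ultimately show False by simp
    qed
  qed
qed

text \<open>Fatou's lemma bounds the limit inferior on each event
  \<open>U 0 \<omega> \<le> real N\<close>. The localisation replaces integrability of
  \<open>U 0\<close>, and these events exhaust the space as \<open>N\<close> grows.\<close>

lemma AE_not_at_top: "AE \<omega> in M. \<not> filterlim (\<lambda>n. U n \<omega>) at_top sequentially"
proof -
  have "AE \<omega> in M. U 0 \<omega> \<le> real N \<longrightarrow> \<not> filterlim (\<lambda>n. U n \<omega>) at_top sequentially" for N :: nat
  proof -
    define g where "g \<omega> = (if U 0 \<omega> \<le> real N then 1 else 0 :: ennreal)" for \<omega>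
    have "g \<in> borel_measurable (G 0)"
      unfolding g_def using supermartingale_adapted[of 0] by measurable
    \<comment> \<open>The indicator is known at time 0, hence at every later time, so one and the
      same \<open>g\<close> can be used at each step of the induction below.\<close>
    then have g: "g \<in> borel_measurable (G n)" for n by (rule measurable_G_mono) simp
    have [measurable]: "g \<in> borel_measurable M" "U n \<in> borel_measurable M" for n
      using g supermartingale_adapted by (auto intro: measurable_G)
    have bound: "(\<integral>\<^sup>+\<omega>. g \<omega> * ennreal (U n \<omega>) \<partial>M) \<le> ennreal (real N)" for n
    proof (induction n)
      case 0
      have "(\<integral>\<^sup>+\<omega>. g \<omega> * ennreal (U 0 \<omega>) \<partial>M) \<le> (\<integral>\<^sup>+\<omega>. ennreal (real N) \<partial>M)"
        by (intro nn_integral_mono) (auto simp: g_def intro: ennreal_leI)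
      then show ?case by (simp add: emeasure_space_1)
    next
      case (Suc n)
      then show ?case using supermartingale_le[OF g, of n] by (rule order_trans[rotated])
    qed
    have "(\<integral>\<^sup>+\<omega>. liminf (\<lambda>n. g \<omega> * ennreal (U n \<omega>)) \<partial>M)
        \<le> liminf (\<lambda>n. \<integral>\<^sup>+\<omega>. g \<omega> * ennreal (U n \<omega>) \<partial>M)"
      by (rule nn_integral_liminf) simp
    also have "\<dots> \<le> limsup (\<lambda>n. \<integral>\<^sup>+\<omega>. g \<omega> * ennreal (U n \<omega>) \<partial>M)"
      by (rule Liminf_le_Limsup) simp
    also have "\<dots> \<le> ennreal (real N)" by (rule Limsup_bounded) (simp add: bound)
    finally have "(\<integral>\<^sup>+\<omega>. liminf (\<lambda>n. g \<omega> * ennreal (U n \<omega>)) \<partial>M) \<noteq> \<infinity>"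
      by (metis ennreal_neq_top infinity_ennreal_def top.extremum_uniqueI)
    then have "AE \<omega> in M. liminf (\<lambda>n. g \<omega> * ennreal (U n \<omega>)) \<noteq> \<infinity>"
      by (intro nn_integral_noteq_infinite) auto
    then show ?thesis
    proof eventually_elim
      case (elim \<omega>)
      show ?case
      proof (intro impI notI)
        assume "U 0 \<omega> \<le> real N" and top: "filterlim (\<lambda>n. U n \<omega>) at_top sequentially"
        then have "g \<omega> = 1" by (simp add: g_def)
        with elim have "liminf (\<lambda>n. ennreal (U n \<omega>)) \<noteq> \<infinity>" by simp
        then obtain B where B: "liminf (\<lambda>n. ennreal (U n \<omega>)) = ennreal B" "0 \<le> B"
          by (cases "liminf (\<lambda>n. ennreal (U n \<omega>))") auto
        have "\<forall>\<^sub>F n in sequentially. B + 1 \<le> U n \<omega>"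
          using top by (simp add: filterlim_at_top)
        then have "\<forall>\<^sub>F n in sequentially. ennreal (B + 1) \<le> ennreal (U n \<omega>)"
          by eventually_elim (rule ennreal_leI)
        then have "ennreal (B + 1) \<le> ennreal B" unfolding B(1)[symmetric] by (rule Liminf_bounded)
        then show False using B(2) by simp
      qed
    qed
  qed
  then have "AE \<omega> in M. \<forall>N::nat. U 0 \<omega> \<le> real N \<longrightarrow> \<not> filterlim (\<lambda>n. U n \<omega>) at_top sequentially"
    unfolding AE_all_countable by blast
  then show ?thesis
    by eventually_elim (meson real_arch_simple)
qed

theorem nonneg_supermartingale_convergent: "AE \<omega> in M. convergent (\<lambda>n. U n \<omega>)"
proof -
  have "AE \<omega> in M. \<forall>(p, q) \<in> {(p, q). p \<in> \<rat> \<and> q \<in> \<rat> \<and> p < q}.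
      \<not> ((\<exists>\<^sub>F n in sequentially. U n \<omega> \<le> p) \<and> (\<exists>\<^sub>F n in sequentially. q \<le> U n \<omega>))"
  proof (rule AE_ball_countable'[rule_format])
    show "countable {(p::real, q::real). p \<in> \<rat> \<and> q \<in> \<rat> \<and> p < q}"
      by (rule countable_subset[of _ "\<rat> \<times> \<rat>"]) (auto intro: countable_rat)
  qed (auto simp: AE_no_oscillation simp del: de_Morgan_conj)
  with AE_not_at_top show ?thesis
  proof eventually_elim
    case (elim \<omega>)
    show ?case
      by (rule convergent_if_no_oscillation) (use elim in \<open>auto simp: supermartingale_nonneg\<close>)
  qed
qed

end

end

section \<open>The Robbins--Siegmund theorem\<close>

text \<open>From \<open>1 + c \<le> exp c\<close>. A discount factor confined to a compact interval
  away from 0 can be removed without affecting convergence or summability.\<close>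

lemma prod_one_plus_bounds:
  fixes c :: "nat \<Rightarrow> real"
  assumes nonneg: "\<And>n. 0 \<le> c n" and "summable c"
  shows "convergent (\<lambda>n. \<Prod>l<n. 1 + c l)" "1 \<le> (\<Prod>l<n. 1 + c l)"
    "(\<Prod>l<n. 1 + c l) \<le> exp (suminf c)"
proof -
  have upper: "(\<Prod>l<n. 1 + c l) \<le> exp (suminf c)" for n
  proof -
    have "(\<Prod>l<n. 1 + c l) \<le> (\<Prod>l<n. exp (c l))"
      using nonneg by (intro prod_mono) (auto simp: add_nonneg_nonneg)
    also have "\<dots> = exp (\<Sum>l<n. c l)" by (simp add: exp_sum)
    also have "\<dots> \<le> exp (suminf c)"
      using assms by (simp add: sum_le_suminf)
    finally show ?thesis .
  qed
  have lower: "1 \<le> (\<Prod>l<n. 1 + c l)" for n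
    using nonneg by (intro prod_ge_1) simp
  have "incseq (\<lambda>n. \<Prod>l<n. 1 + c l)"
  proof (rule incseq_SucI)
    fix n
    have "(\<Prod>l<n. 1 + c l) * 1 \<le> (\<Prod>l<n. 1 + c l) * (1 + c n)"
      using lower[of n] nonneg[of n] by (intro mult_left_mono) auto
    then show "(\<Prod>l<n. 1 + c l) \<le> (\<Prod>l<Suc n. 1 + c l)" by (simp add: mult.commute)
  qed
  then obtain L where "(\<lambda>n. \<Prod>l<n. 1 + c l) \<longlonglongrightarrow> L"
    using incseq_convergent[of _ "exp (suminf c)"] upper by blast
  then show "convergent (\<lambda>n. \<Prod>l<n. 1 + c l)" by (rule convergentI)
  show "1 \<le> (\<Prod>l<n. 1 + c l)" "(\<Prod>l<n. 1 + c l) \<le> exp (suminf c)"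
    by (rule lower upper)+
qed

text \<open>Both discounted terms are nonnegative, so a bound for their sum bounds the partial sums
  of the series. Once that series converges, it is subtracted and the rest is multiplied by the
  convergent \<open>P\<close>.\<close>

lemma discounted_convergent_imp:
  fixes X Z c :: "nat \<Rightarrow> real"
  defines "P \<equiv> \<lambda>n. \<Prod>l<n. 1 + c l"
  assumes X: "\<And>n. 0 \<le> X n" and Z: "\<And>n. 0 \<le> Z n" and c: "\<And>n. 0 \<le> c n" "summable c"
    and conv: "convergent (\<lambda>n. X n / P n + (\<Sum>l<n. Z l / P (Suc l)))"
  shows "convergent X \<and> summable Z"
proof -
  have P: "convergent P" "1 \<le> P n" "P n \<le> exp (suminf c)" for n
    unfolding P_def by (rule prod_one_plus_bounds c)+
  have P_pos: "0 < P n" for n using P(2)[of n] by linarith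
  obtain B where B: "X n / P n + (\<Sum>l<n. Z l / P (Suc l)) \<le> B" for n
    using convergent_imp_Bseq[OF conv] unfolding Bseq_def by (metis abs_le_D1 real_norm_def)
  have ZP: "summable (\<lambda>l. Z l / P (Suc l))"
  proof (rule summableI_nonneg_bounded)
    show "0 \<le> Z n / P (Suc n)" for n using Z P_pos[of "Suc n"] by simp
    show "(\<Sum>l<n. Z l / P (Suc l)) \<le> B" for n
    proof -
      have "0 \<le> X n / P n" using X P_pos[of n] by simp
      with B[of n] show ?thesis by simp
    qed
  qed
  have "summable Z"
  proof (rule summable_comparison_test'[OF summable_mult[OF ZP, of "exp (suminf c)"]])
    fix n :: nat
    have "P (Suc n) * (Z n / P (Suc n)) \<le> exp (suminf c) * (Z n / P (Suc n))"
      using P(3)[of "Suc n"] Z[of n] P_pos[of "Suc n"] by (intro mult_right_mono) auto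
    moreover have "P (Suc n) * (Z n / P (Suc n)) = Z n" using P_pos[of "Suc n"] by simp
    ultimately show "norm (Z n) \<le> exp (suminf c) * (Z n / P (Suc n))" using Z[of n] by simp
  qed
  moreover have "convergent X"
  proof -
    have "convergent (\<lambda>n. \<Sum>l<n. Z l / P (Suc l))"
      using ZP by (simp add: summable_iff_convergent)
    with conv have "convergent (\<lambda>n. X n / P n + (\<Sum>l<n. Z l / P (Suc l)) - (\<Sum>l<n. Z l / P (Suc l)))"
      by (rule convergent_diff)
    then have "convergent (\<lambda>n. P n * (X n / P n))"
      using P(1) by (intro convergent_mult) auto
    moreover have "P n * (X n / P n) = X n" for n using P_pos[of n] by simp
    ultimately show ?thesis by simp
  qed
  ultimately show ?thesis by simp
qed

context filtered_prob_space
begin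

text \<open>Discounting by \<open>P\<close> removes the growth factor, and adding the accumulated
  discounted \<open>Z\<close> gives a nonnegative supermartingale \<open>U\<close>. The discount is
  then undone path by path with \<open>discounted_convergent_imp\<close>.\<close>

theorem robbins_siegmund:
  fixes X Z a b :: "nat \<Rightarrow> 'a \<Rightarrow> real"
  assumes X: "\<And>n. X n \<in> borel_measurable (G n)" "\<And>n \<omega>. 0 \<le> X n \<omega>"
    and Z: "\<And>n. Z n \<in> borel_measurable (G n)" "\<And>n \<omega>. 0 \<le> Z n \<omega>"
    and a: "AE \<omega> in M. \<forall>n. 0 \<le> a n \<omega>" "AE \<omega> in M. summable (\<lambda>n. a n \<omega>)"
    and b: "AE \<omega> in M. \<forall>n. 0 \<le> b n \<omega>" "AE \<omega> in M. summable (\<lambda>n. b n \<omega>)"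
    and rel: "\<And>n. AE \<omega> in M. enn2ereal (nn_cond_exp M (G n) (\<lambda>\<omega>. ennreal (X (Suc n) \<omega>)) \<omega>)
      \<le> ereal ((1 + a n \<omega>) * X n \<omega> + b n \<omega> - Z n \<omega>)"
  shows "AE \<omega> in M. convergent (\<lambda>n. X n \<omega>) \<and> summable (\<lambda>n. Z n \<omega>)"
proof -
  define E where "E n \<omega> = enn2real (nn_cond_exp M (G n) (\<lambda>\<omega>. ennreal (X (Suc n) \<omega>)) \<omega>)" for n \<omega>
  \<comment> \<open>\<open>a\<close> and \<open>b\<close> need not be adapted. The sequence \<open>c\<close> is, it bounds
    \<open>E + Z\<close> by \<open>X + c (X + 1)\<close>, and \<open>c \<le> a + b\<close> almost surely.\<close>
  define c where "c n \<omega> = max 0 ((E n \<omega> + Z n \<omega> - X n \<omega>) / (X n \<omega> + 1))" for n \<omega>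
  define P where "P n \<omega> = (\<Prod>l<n. 1 + c l \<omega>)" for n \<omega>
  \<comment> \<open>The 1 added to \<open>X\<close> lets the growth factor absorb the additive noise
    too, since \<open>b\<close> is at most \<open>b * (X + 1)\<close>.\<close>
  define U where "U n \<omega> = (X n \<omega> + 1) / P n \<omega> + (\<Sum>l<n. Z l \<omega> / P (Suc l) \<omega>)" for n \<omega>
  have E_meas: "E n \<in> borel_measurable (G n)" for n
    unfolding E_def by measurable
  have E_nonneg: "0 \<le> E n \<omega>" for n \<omega> by (simp add: E_def)
  have c_meas: "c n \<in> borel_measurable (G n)" for n
    unfolding c_def using E_meas[of n] X(1)[of n] Z(1)[of n] by measurable
  have c_nonneg: "0 \<le> c n \<omega>" for n \<omega> by (simp add: c_def)
  have P_ge: "1 \<le> P n \<omega>" for n \<omega>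
    unfolding P_def using c_nonneg by (intro prod_ge_1) simp
  then have P_pos: "0 < P n \<omega>" for n \<omega> by (meson less_le_trans zero_less_one)
  have P_Suc: "P (Suc n) \<omega> = P n \<omega> * (1 + c n \<omega>)" for n \<omega> by (simp add: P_def)
  \<comment> \<open>Predictability: \<open>P (Suc l)\<close> involves \<open>c\<close> only up to
    index \<open>l\<close>, so it is already known at time \<open>l\<close>.\<close>
  have P_meas: "P (Suc l) \<in> borel_measurable (G n)" if "l \<le> n" for l n
    unfolding P_def using that
    by (intro borel_measurable_prod borel_measurable_add borel_measurable_const
        measurable_G_mono[OF c_meas]) auto
  have P_meas': "P n \<in> borel_measurable (G n)" for n
  proof (cases n)
    case 0
    then have "P n = (\<lambda>_. 1)" by (simp add: P_def fun_eq_iff)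
    then show ?thesis by simp
  next
    case (Suc l)
    then show ?thesis using P_meas[of l n] by simp
  qed
  \<comment> \<open>The bound \<open>Suc n\<close> is deliberate: the summand with index
    \<open>n\<close> uses \<open>Z n\<close> and \<open>P (Suc n)\<close>, both known at time
    \<open>n\<close>.\<close>
  have sum_meas: "(\<lambda>\<omega>. \<Sum>l<m. Z l \<omega> / P (Suc l) \<omega>) \<in> borel_measurable (G n)" if "m \<le> Suc n" for m n
    using that by (intro borel_measurable_sum borel_measurable_divide P_meas
        measurable_G_mono[OF Z(1)]) auto
  have Zsum_nonneg: "0 \<le> (\<Sum>l<m. Z l \<omega> / P (Suc l) \<omega>)" for m \<omega>
    using Z(2) P_pos by (intro sum_nonneg divide_nonneg_pos) auto
  \<comment> \<open>The right-hand side of \<open>rel\<close> is a real number, so the conditional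
    expectation is almost surely finite and passing through \<open>enn2real\<close> loses
    nothing.\<close>
  have E: "AE \<omega> in M. nn_cond_exp M (G n) (\<lambda>\<omega>. ennreal (X (Suc n) \<omega>)) \<omega> = ennreal (E n \<omega>)
      \<and> E n \<omega> + Z n \<omega> \<le> (1 + a n \<omega>) * X n \<omega> + b n \<omega>" for n
    using rel[of n]
  proof eventually_elim
    case (elim \<omega>)
    then have "nn_cond_exp M (G n) (\<lambda>\<omega>. ennreal (X (Suc n) \<omega>)) \<omega> \<noteq> \<top>" by auto
    then have eq: "nn_cond_exp M (G n) (\<lambda>\<omega>. ennreal (X (Suc n) \<omega>)) \<omega> = ennreal (E n \<omega>)"
      by (simp add: E_def less_top)
    with elim E_nonneg[of n \<omega>] show ?case by (simp add: enn2ereal_ennreal)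
  qed
  have "nonneg_supermartingale U"
    unfolding nonneg_supermartingale_def
  proof (intro conjI allI impI)
    show "U n \<in> borel_measurable (G n)" for n
      unfolding U_def using X(1)[of n] P_meas'[of n] sum_meas[of n n]
      by (intro borel_measurable_add borel_measurable_divide) auto
    show "0 \<le> U n \<omega>" for n \<omega>
      unfolding U_def using X(2)[of n \<omega>] P_pos[of n \<omega>] Zsum_nonneg by (intro add_nonneg_nonneg) auto
    fix n and g :: "'a \<Rightarrow> ennreal"
    assume g: "g \<in> borel_measurable (G n)"
    \<comment> \<open>\<open>W\<close> collects all of \<open>U (Suc n)\<close> that is known at
      time \<open>n\<close>; only \<open>X (Suc n)\<close> has to be conditioned. Its discount
      factor is moved into the test function \<open>h\<close>.\<close>
    define W where "W \<omega> = 1 / P (Suc n) \<omega> + (\<Sum>l<Suc n. Z l \<omega> / P (Suc l) \<omega>)" for \<omega>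
    define h where "h \<omega> = g \<omega> * ennreal (1 / P (Suc n) \<omega>)" for \<omega>
    have h: "h \<in> borel_measurable (G n)"
      unfolding h_def using g P_meas[of n n] by measurable
    have "W \<in> borel_measurable (G n)"
      unfolding W_def using P_meas[of n n] sum_meas[of "Suc n" n]
      by (intro borel_measurable_add borel_measurable_divide) auto
    then have [measurable]: "W \<in> borel_measurable M" by (rule measurable_G)
    have [measurable]: "h \<in> borel_measurable M" "g \<in> borel_measurable M" "E n \<in> borel_measurable M"
      "X m \<in> borel_measurable M" for m
      using h g E_meas X(1) by (auto intro: measurable_G)
    have W_nonneg: "0 \<le> W \<omega>" for \<omega>
      unfolding W_def using P_pos[of "Suc n" \<omega>] Zsum_nonneg by (intro add_nonneg_nonneg) (auto simp del: sum.lessThan_Suc)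
    have split: "g \<omega> * ennreal (y / P (Suc n) \<omega> + W \<omega>) = h \<omega> * ennreal y + g \<omega> * ennreal (W \<omega>)"
      if "0 \<le> y" for y \<omega>
    proof -
      have "ennreal (y / P (Suc n) \<omega> + W \<omega>) = ennreal (1 / P (Suc n) \<omega>) * ennreal y + ennreal (W \<omega>)"
        using that W_nonneg[of \<omega>] P_pos[of "Suc n" \<omega>] by (simp add: ennreal_mult[symmetric])
      then show ?thesis by (simp add: h_def distrib_left mult.assoc)
    qed
    have U_Suc: "U (Suc n) \<omega> = X (Suc n) \<omega> / P (Suc n) \<omega> + W \<omega>" for \<omega>
      by (simp add: U_def W_def add_divide_distrib)
    \<comment> \<open>By the choice of \<open>c\<close>, the expected growth including
      \<open>Z n\<close> is at most the factor \<open>1 + c n\<close>, which is exactly the factor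
      gained by \<open>P\<close> in this step.\<close>
    have drift: "E n \<omega> / P (Suc n) \<omega> + W \<omega> \<le> U n \<omega>" for \<omega>
    proof -
      have "E n \<omega> + Z n \<omega> - X n \<omega> \<le> c n \<omega> * (X n \<omega> + 1)"
        using X(2)[of n \<omega>] by (simp add: c_def pos_divide_le_eq[symmetric])
      then have "E n \<omega> + 1 + Z n \<omega> \<le> (X n \<omega> + 1) * (1 + c n \<omega>)"
        by (simp add: algebra_simps)
      then have "(E n \<omega> + 1 + Z n \<omega>) / P (Suc n) \<omega> \<le> (X n \<omega> + 1) * (1 + c n \<omega>) / P (Suc n) \<omega>"
        using P_pos[of "Suc n" \<omega>] by (intro divide_right_mono) auto
      also have "\<dots> = (X n \<omega> + 1) / P n \<omega>"
        using c_nonneg[of n \<omega>] by (simp add: P_Suc)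
      finally show ?thesis by (simp add: U_def W_def add_divide_distrib)
    qed
    have "(\<integral>\<^sup>+\<omega>. g \<omega> * ennreal (U (Suc n) \<omega>) \<partial>M)
        = (\<integral>\<^sup>+\<omega>. h \<omega> * ennreal (X (Suc n) \<omega>) + g \<omega> * ennreal (W \<omega>) \<partial>M)"
      using X(2) by (simp add: U_Suc split)
    also have "\<dots> = (\<integral>\<^sup>+\<omega>. h \<omega> * ennreal (X (Suc n) \<omega>) \<partial>M) + (\<integral>\<^sup>+\<omega>. g \<omega> * ennreal (W \<omega>) \<partial>M)"
      by (intro nn_integral_add) auto
    also have "(\<integral>\<^sup>+\<omega>. h \<omega> * ennreal (X (Suc n) \<omega>) \<partial>M)
        = (\<integral>\<^sup>+\<omega>. h \<omega> * nn_cond_exp M (G n) (\<lambda>\<omega>. ennreal (X (Suc n) \<omega>)) \<omega> \<partial>M)"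
      using h by (intro sigma_finite_subalgebra.nn_cond_exp_intg[OF sigma_finite_subalgebra_G, symmetric]) auto
    also have "\<dots> = (\<integral>\<^sup>+\<omega>. h \<omega> * ennreal (E n \<omega>) \<partial>M)"
      by (rule nn_integral_cong_AE) (use E[of n] in eventually_elim, simp)
    also have "(\<integral>\<^sup>+\<omega>. h \<omega> * ennreal (E n \<omega>) \<partial>M) + (\<integral>\<^sup>+\<omega>. g \<omega> * ennreal (W \<omega>) \<partial>M)
        = (\<integral>\<^sup>+\<omega>. h \<omega> * ennreal (E n \<omega>) + g \<omega> * ennreal (W \<omega>) \<partial>M)"
      by (intro nn_integral_add[symmetric]) auto
    also have "\<dots> = (\<integral>\<^sup>+\<omega>. g \<omega> * ennreal (E n \<omega> / P (Suc n) \<omega> + W \<omega>) \<partial>M)"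
      using E_nonneg by (simp add: split)
    also have "\<dots> \<le> (\<integral>\<^sup>+\<omega>. g \<omega> * ennreal (U n \<omega>) \<partial>M)"
      by (intro nn_integral_mono mult_left_mono ennreal_leI drift) auto
    finally show "(\<integral>\<^sup>+\<omega>. g \<omega> * ennreal (U (Suc n) \<omega>) \<partial>M) \<le> (\<integral>\<^sup>+\<omega>. g \<omega> * ennreal (U n \<omega>) \<partial>M)" .
  qed
  then have "AE \<omega> in M. convergent (\<lambda>n. U n \<omega>)" by (rule nonneg_supermartingale_convergent)
  moreover have "AE \<omega> in M. \<forall>n. E n \<omega> + Z n \<omega> \<le> (1 + a n \<omega>) * X n \<omega> + b n \<omega>"
    unfolding AE_all_countable using E by (auto elim: AE_mp)
  ultimately show ?thesis using a b
  proof eventually_elim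
    case (elim \<omega>)
    have "c n \<omega> \<le> a n \<omega> + b n \<omega>" for n
    proof -
      have "E n \<omega> + Z n \<omega> - X n \<omega> \<le> a n \<omega> * X n \<omega> + b n \<omega>"
        using elim(2) by (simp add: algebra_simps)
      also have "\<dots> \<le> (a n \<omega> + b n \<omega>) * (X n \<omega> + 1)"
        using elim(3,5) X(2)[of n \<omega>] by (simp add: algebra_simps)
      finally show ?thesis
        using elim(3,5) X(2)[of n \<omega>] by (simp add: c_def pos_divide_le_eq)
    qed
    then have "summable (\<lambda>n. c n \<omega>)"
      using c_nonneg by (intro summable_comparison_test'[OF summable_add[OF elim(4,6)]]) simp
    moreover have "convergent (\<lambda>n. (X n \<omega> + 1) / (\<Prod>l<n. 1 + c l \<omega>)
        + (\<Sum>l<n. Z l \<omega> / (\<Prod>l<Suc l. 1 + c l \<omega>)))"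
      using elim(1) by (simp add: U_def P_def)
    ultimately have "convergent (\<lambda>n. X n \<omega> + 1) \<and> summable (\<lambda>n. Z n \<omega>)"
      using X(2) Z(2) c_nonneg by (intro discounted_convergent_imp) (auto simp: add_nonneg_nonneg)
    then show ?case by (simp add: convergent_add_const_right_iff)
  qed
qed

end

section \<open>Gradients and convexity\<close>

lemma GDERIV_unique:
  assumes "GDERIV f x :> g" "GDERIV f x :> g'"
  shows "g = g'"
proof -
  have "(\<lambda>h. h \<bullet> g) = (\<lambda>h. h \<bullet> g')"
    using assms unfolding gderiv_def by (rule has_derivative_unique)
  then have "h \<bullet> g = h \<bullet> g'" for h by (rule fun_cong)
  then have "(g - g') \<bullet> (g - g') = 0" by (simp add: inner_diff_right)
  then show ?thesis by simp
qed

lemma grad_eqI: "GDERIV f x :> g \<Longrightarrow> grad f x = g"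
  unfolding grad_def using GDERIV_unique by blast

text \<open>In finite dimension the vector representing the derivative is read off from its values
  on the basis.\<close>

lemma GDERIV_grad:
  fixes f :: "'a::euclidean_space \<Rightarrow> real"
  assumes "f differentiable (at x)"
  shows "GDERIV f x :> grad f x"
proof -
  obtain D where D: "(f has_derivative D) (at x)"
    using assms by (auto simp: differentiable_def)
  interpret D: bounded_linear D using D by (rule has_derivative_bounded_linear)
  have "D h = h \<bullet> (\<Sum>b\<in>Basis. D b *\<^sub>R b)" for h
  proof -
    have "D h = D (\<Sum>b\<in>Basis. (h \<bullet> b) *\<^sub>R b)" by (simp add: euclidean_representation)
    then show ?thesis by (simp add: D.sum D.scaleR inner_sum_right mult.commute)
  qed
  then have "D = (\<lambda>h. h \<bullet> (\<Sum>b\<in>Basis. D b *\<^sub>R b))" by (rule ext)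
  then have "GDERIV f x :> (\<Sum>b\<in>Basis. D b *\<^sub>R b)" using D unfolding gderiv_def by metis
  with grad_eqI[OF this] show ?thesis by simp
qed

text \<open>Carries continuity from the gradients of the \<open>f i\<close>, where the Lipschitz
  bound is assumed, to the gradient of their mean.\<close>

lemma grad_mean:
  fixes f :: "'i \<Rightarrow> 'a::euclidean_space \<Rightarrow> real"
  assumes "\<And>i. f i differentiable (at x)"
  shows "grad (\<lambda>\<theta>. c * (\<Sum>i\<in>I. f i \<theta>)) x = c *\<^sub>R (\<Sum>i\<in>I. grad (f i) x)"
proof (rule grad_eqI)
  have "(f i has_derivative (\<lambda>h. h \<bullet> grad (f i) x)) (at x)" for i
    using GDERIV_grad[OF assms] by (simp add: gderiv_def)
  then have "((\<lambda>\<theta>. c * (\<Sum>i\<in>I. f i \<theta>)) has_derivative (\<lambda>h. c * (\<Sum>i\<in>I. h \<bullet> grad (f i) x))) (at x)"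
    by (intro has_derivative_mult_right has_derivative_sum)
  then show "GDERIV (\<lambda>\<theta>. c * (\<Sum>i\<in>I. f i \<theta>)) x :> c *\<^sub>R (\<Sum>i\<in>I. grad (f i) x)"
    by (simp add: gderiv_def inner_sum_right)
qed

text \<open>On the line through \<open>p\<close> and \<theta> the function is convex in one
  variable, and its tangent at parameter 0 is horizontal.\<close>

lemma convex_grad_zero_imp_minimum:
  fixes F :: "'a::euclidean_space \<Rightarrow> real"
  assumes "convex_on UNIV F" "F differentiable (at p)" "grad F p = 0"
  shows "F p \<le> F \<theta>"
proof -
  define g where "g t = F (p + t *\<^sub>R (\<theta> - p))" for t :: real
  have "convex_on UNIV g"
  proof (rule convex_onI)
    fix t r s :: real assume t: "0 < t" "t < 1"
    have "p + ((1 - t) *\<^sub>R r + t *\<^sub>R s) *\<^sub>R (\<theta> - p) =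
        (1 - t) *\<^sub>R (p + r *\<^sub>R (\<theta> - p)) + t *\<^sub>R (p + s *\<^sub>R (\<theta> - p))"
      by (simp add: algebra_simps)
    then show "g ((1 - t) *\<^sub>R r + t *\<^sub>R s) \<le> (1 - t) * g r + t * g s"
      unfolding g_def using t convex_onD[OF assms(1), of t] by simp
  qed simp
  moreover have "(g has_field_derivative 0) (at 0 within UNIV)"
  proof -
    have "(F has_derivative (\<lambda>h. h \<bullet> grad F p)) (at (p + 0 *\<^sub>R (\<theta> - p)))"
      using GDERIV_grad[OF assms(2)] by (simp add: gderiv_def)
    moreover have "((\<lambda>t::real. p + t *\<^sub>R (\<theta> - p)) has_derivative (\<lambda>t. t *\<^sub>R (\<theta> - p))) (at 0)"
      by (auto intro!: derivative_eq_intros)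
    ultimately have "(g has_derivative (\<lambda>t. (t *\<^sub>R (\<theta> - p)) \<bullet> grad F p)) (at 0)"
      unfolding g_def by (rule has_derivative_compose[rotated])
    then show ?thesis by (simp add: assms(3) has_field_derivative_def mult_zero_left[abs_def])
  qed
  ultimately have "0 * (1 - 0) \<le> g 1 - g 0"
    by (intro convex_on_imp_above_tangent[of UNIV]) auto
  then show ?thesis by (simp add: g_def)
qed

section \<open>Weighted series and the weighted matrix norm\<close>

lemma not_summable_if_sums_at_top:
  fixes w :: "nat \<Rightarrow> real"
  assumes "filterlim (\<lambda>n. \<Sum>k<n. w k) at_top sequentially"
  shows "\<not> summable w"
proof
  assume "summable w"
  then have "(\<lambda>n. \<Sum>k<n. w k) \<longlonglongrightarrow> suminf w" by (rule summable_LIMSEQ)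
  then show False
    using not_tendsto_and_filterlim_at_infinity[OF sequentially_bot]
      filterlim_at_top_imp_at_infinity[OF assms] by blast
qed

text \<open>If \<open>s\<close> stayed at or above \<open>e\<close>, then \<open>w\<close> would be
  dominated by \<open>w * s / e\<close> and hence be summable.\<close>

lemma frequently_less_if_weighted_summable:
  fixes w s :: "nat \<Rightarrow> real"
  assumes "\<And>n. 0 \<le> w n" "\<not> summable w" "summable (\<lambda>n. w n * s n)" "0 < e"
  shows "\<exists>\<^sub>F n in sequentially. s n < e"
proof (rule ccontr)
  assume "\<not> ?thesis"
  then have "\<forall>\<^sub>F n in sequentially. e \<le> s n"
    unfolding not_frequently by eventually_elim auto
  then have "\<forall>\<^sub>F n in sequentially. norm (w n) \<le> w n * s n / e"
  proof eventually_elim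
    case (elim n)
    then have "w n * e \<le> w n * s n" using assms(1) by (intro mult_left_mono) auto
    then show ?case using assms(1)[of n] assms(4) by (simp add: field_simps)
  qed
  then have "summable w"
    using summable_divide[OF assms(3)] by (rule summable_comparison_test_ev)
  with assms(2) show False by simp
qed

lemma tendsto_zero_if_weighted_summable:
  fixes w s :: "nat \<Rightarrow> real"
  assumes "\<And>n. 0 \<le> w n" "\<not> summable w" "summable (\<lambda>n. w n * s n)" "\<And>n. 0 \<le> s n" "convergent s"
  shows "s \<longlonglongrightarrow> 0"
proof -
  obtain l where l: "s \<longlonglongrightarrow> l" using assms(5) by (auto simp: convergent_def)
  have "l \<le> 0"
  proof (rule ccontr)
    assume "\<not> ?thesis"
    then have "\<forall>\<^sub>F n in sequentially. l / 2 < s n" using l by (intro order_tendstoD) auto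
    moreover have "\<exists>\<^sub>F n in sequentially. s n < l / 2"
      using assms(1-3) \<open>\<not> l \<le> 0\<close> by (intro frequently_less_if_weighted_summable[of w]) auto
    ultimately have "\<exists>\<^sub>F n in sequentially. l / 2 < s n \<and> s n < l / 2"
      by (simp add: frequently_eventually_conj)
    then show False by (auto dest: frequently_ex)
  qed
  moreover have "0 \<le> l" using l by (rule LIMSEQ_le_const) (use assms(4) in auto)
  ultimately show ?thesis using l by simp
qed

lemma continuous_on_mnorm:
  assumes "continuous_on S g"
  shows "continuous_on S (\<lambda>z. mnorm W (g z))"
proof -
  have "(\<lambda>z. mnorm W (g z)) = (\<lambda>z. norm (\<chi> j. norm (\<chi> i. \<Sum>k\<in>UNIV. W $ i $ k * g z $ k $ j)))"
    by (simp add: mnorm_def wnorm_def column_def matrix_vector_mult_def)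
  then show ?thesis using assms by (simp only:) (intro continuous_intros)
qed

text \<open>The weighted norm controls \<open>W\<close> applied to each column; a left inverse of
  \<open>W\<close> recovers the columns and thereby the entries of each row.\<close>

lemma tendsto_rows_if_mnorm:
  fixes Z :: "nat \<Rightarrow> real^'d::finite^'m::finite"
  assumes "invertible W" "(\<lambda>k. (mnorm W (Z k))\<^sup>2) \<longlonglongrightarrow> 0"
  shows "(\<lambda>k. Z k $ i) \<longlonglongrightarrow> 0"
proof (rule vec_tendstoI)
  fix j
  obtain W' where W': "W' ** W = mat 1" using assms(1) by (auto simp: invertible_def)
  have "(\<lambda>k. sqrt ((mnorm W (Z k))\<^sup>2)) \<longlonglongrightarrow> sqrt 0"
    using assms(2) by (rule tendsto_real_sqrt)
  then have lim: "(\<lambda>k. mnorm W (Z k)) \<longlonglongrightarrow> 0" by (simp add: mnorm_def)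
  have "norm (W *v column j (Z k)) \<le> mnorm W (Z k)" for k
  proof -
    have "norm ((\<chi> j. wnorm W (column j (Z k))) $ j) \<le> mnorm W (Z k)"
      unfolding mnorm_def by (rule Finite_Cartesian_Product.norm_nth_le)
    then show ?thesis by (simp add: wnorm_def)
  qed
  then have "(\<lambda>k. W *v column j (Z k)) \<longlonglongrightarrow> 0"
    by (intro Lim_null_comparison[OF _ lim] always_eventually) auto
  then have "(\<lambda>k. W' *v (W *v column j (Z k))) \<longlonglongrightarrow> W' *v 0"
    by (rule bounded_linear.tendsto[OF matrix_vector_mul_bounded_linear])
  then have "(\<lambda>k. column j (Z k)) \<longlonglongrightarrow> 0"
    by (simp add: matrix_vector_mul_assoc W')
  then have "(\<lambda>k. column j (Z k) $ i) \<longlonglongrightarrow> 0 $ i" by (rule tendsto_vec_nth)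
  then show "(\<lambda>k. Z k $ i $ j) \<longlonglongrightarrow> 0 $ j" by (simp add: column_def)
qed

lemma row_deviation_avg: "(Y - diag v ** rows_of c) $ i = Y $ i - v $ i *\<^sub>R c"
proof -
  have "(\<Sum>k\<in>UNIV. (if i = k then v $ i else 0) * c $ j) = v $ i * c $ j" for j
    by (simp add: sum_distrib_right[symmetric])
  then show ?thesis
    by (simp add: vec_eq_iff matrix_matrix_mult_def diag_def rows_of_def)
qed

section \<open>Minimising sequences of convex functions\<close>

text \<open>Along a subsequence the gradients vanish, and bounded level sets give it a cluster
  point. Convexity makes that point a minimiser, and since all values \<open>F (z k)\<close> share
  one limit, this limit is the minimum.\<close>

lemma convex_bounded_levels_convergence:
  fixes F :: "'a::euclidean_space \<Rightarrow> real" and z :: "nat \<Rightarrow> 'a"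
  assumes convex: "convex_on UNIV F" and diff: "\<And>\<theta>. F differentiable (at \<theta>)"
    and grad_cont: "continuous_on UNIV (grad F)"
    and min: "\<And>\<theta>. F \<theta>\<^sub>0 \<le> F \<theta>"
    and levels: "\<And>c. bounded {\<theta>. F \<theta> \<le> c}"
    and conv: "convergent (\<lambda>k. F (z k))"
    and grad_small: "\<And>e. 0 < e \<Longrightarrow> \<exists>\<^sub>F k in sequentially. norm (grad F (z k)) < e"
  shows "bounded (range z)" "(\<lambda>k. F (z k)) \<longlonglongrightarrow> F \<theta>\<^sub>0"
proof -
  obtain l where l: "(\<lambda>k. F (z k)) \<longlonglongrightarrow> l" using conv by (auto simp: convergent_def)
  obtain B where B: "norm (F (z k)) \<le> B" for k
    using convergent_imp_Bseq[OF conv] unfolding Bseq_def by blast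
  have "range z \<subseteq> {\<theta>. F \<theta> \<le> B}" using B by (auto simp: abs_le_iff)
  then show bdd: "bounded (range z)" using levels bounded_subset by blast
  have F_cont: "continuous_on UNIV F"
    using diff by (simp add: continuous_at_imp_continuous_on differentiable_imp_continuous_within)
  \<comment> \<open>Indices are chosen recursively: frequent smallness always offers a later index
    with gradient below the next threshold.\<close>
  have "\<exists>s. strict_mono s \<and> (\<forall>n. norm (grad F (z (s n))) < 1 / real (Suc n))"
  proof -
    have step: "\<exists>j. norm (grad F (z j)) < 1 / real (Suc n) \<and> k < j" for n k
    proof -
      have "\<exists>\<^sub>F j in sequentially. norm (grad F (z j)) < 1 / real (Suc n)"
        by (rule grad_small) simp
      then obtain j where "Suc k \<le> j" "norm (grad F (z j)) < 1 / real (Suc n)"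
        unfolding frequently_sequentially by blast
      then show ?thesis by (intro exI[of _ j]) simp
    qed
    have "\<exists>s. \<forall>n. norm (grad F (z (s n))) < 1 / real (Suc n) \<and> s n < s (Suc n)"
    proof (rule dependent_nat_choice)
      show "\<exists>k. norm (grad F (z k)) < 1 / real (Suc 0)" using step[of 0 0] by blast
    qed (rule step)
    then show ?thesis by (auto simp: strict_mono_Suc_iff)
  qed
  then obtain s where s: "strict_mono s" "\<And>n. norm (grad F (z (s n))) < 1 / real (Suc n)" by blast
  have "bounded (range (z \<circ> s))" using bdd by (rule bounded_subset) auto
  then obtain r p where r: "strict_mono r" "((z \<circ> s) \<circ> r) \<longlonglongrightarrow> p"
    using bounded_imp_convergent_subsequence by blast
  then have p: "(\<lambda>n. z (s (r n))) \<longlonglongrightarrow> p" by (simp add: o_def)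
  have "(\<lambda>n. grad F (z (s n))) \<longlonglongrightarrow> 0"
    by (rule Lim_null_comparison[OF _ lim_inverse_n'[THEN LIMSEQ_Suc]])
      (use s(2) in \<open>auto intro!: always_eventually less_imp_le\<close>)
  then have "(\<lambda>n. grad F (z (s (r n)))) \<longlonglongrightarrow> 0"
    using LIMSEQ_subseq_LIMSEQ[OF _ r(1)] by (auto simp: o_def)
  moreover have "(\<lambda>n. grad F (z (s (r n)))) \<longlonglongrightarrow> grad F p"
    using grad_cont p by (rule continuous_on_tendsto_compose) auto
  ultimately have "grad F p = 0" by (rule LIMSEQ_unique[rotated])
  then have "F p \<le> F \<theta>\<^sub>0" by (intro convex_grad_zero_imp_minimum convex diff)
  with min have Fp: "F p = F \<theta>\<^sub>0" by (simp add: order_antisym)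
  have "(\<lambda>n. F (z (s (r n)))) \<longlonglongrightarrow> F p"
    using F_cont p by (rule continuous_on_tendsto_compose) auto
  moreover have "(\<lambda>n. F (z (s (r n)))) \<longlonglongrightarrow> l"
    using LIMSEQ_subseq_LIMSEQ[OF LIMSEQ_subseq_LIMSEQ[OF l s(1)] r(1)] by (simp add: o_def)
  ultimately have "l = F \<theta>\<^sub>0" using Fp LIMSEQ_unique by blast
  with l show "(\<lambda>k. F (z k)) \<longlonglongrightarrow> F \<theta>\<^sub>0" by simp
qed

text \<open>Both sequences lie in one compact set, where \<open>F\<close> is uniformly continuous,
  so their values differ by a null sequence.\<close>

lemma continuous_bounded_asymptotic:
  fixes F :: "'a::euclidean_space \<Rightarrow> real" and z w :: "nat \<Rightarrow> 'a"
  assumes "continuous_on UNIV F" "bounded (range z)" "(\<lambda>k. w k - z k) \<longlonglongrightarrow> 0" "(\<lambda>k. F (z k)) \<longlonglongrightarrow> l"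
  shows "(\<lambda>k. F (w k)) \<longlonglongrightarrow> l"
proof -
  have "bounded (range (\<lambda>k. w k - z k))"
    using assms(3) by (rule convergent_imp_bounded)
  with assms(2) have "bounded (range (\<lambda>k. z k + (w k - z k)))"
    by (rule bounded_plus_comp)
  then have "bounded (range z \<union> range w)" using assms(2) by simp
  then have K: "compact (closure (range z \<union> range w))" by (simp only: compact_closure)
  have uc: "uniformly_continuous_on (closure (range z \<union> range w)) F"
    by (rule compact_uniformly_continuous[OF continuous_on_subset[OF assms(1)] K]) simp
  have "(\<lambda>k. dist (w k) (z k)) \<longlonglongrightarrow> 0"
    using tendsto_norm[OF assms(3)] by (simp add: dist_norm)
  moreover have "z k \<in> closure (range z \<union> range w)" "w k \<in> closure (range z \<union> range w)" for k
    by (auto intro!: closure_subset[THEN subsetD])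
  ultimately have "(\<lambda>k. dist (F (w k)) (F (z k))) \<longlonglongrightarrow> 0"
    by (intro uniformly_continuous_on_sequentially[THEN iffD1, OF uc, rule_format]) simp
  then have "(\<lambda>k. F (w k) - F (z k)) \<longlonglongrightarrow> 0"
    by (simp add: dist_norm tendsto_rabs_zero_iff)
  from tendsto_add[OF this assms(4)] show ?thesis by simp
qed

section \<open>Coupled recursions\<close>

context filtered_prob_space
begin

text \<open>The conditions \<open>small\<close> let the decay in rows two and three pay for the
  coupling in row one, and let half of the \<open>k6\<close> term pay for every positive multiple of
  \<open>s\<close>. They are required at every index, so an initial segment must be cut off before
  this is applied.\<close>

theorem coupled_robbins_siegmund:
  fixes e1 e2 e3 d s a b :: "nat \<Rightarrow> 'a \<Rightarrow> real" and l g1 g2 :: "nat \<Rightarrow> real"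
    and k1 k2 k3 k4 k5 k6 k7 k8 k9 :: real
  assumes meas: "\<And>n. e1 n \<in> borel_measurable (G n)" "\<And>n. e2 n \<in> borel_measurable (G n)"
      "\<And>n. e3 n \<in> borel_measurable (G n)" "\<And>n. d n \<in> borel_measurable (G n)"
      "\<And>n. s n \<in> borel_measurable (G n)"
    and nonneg: "\<And>n \<omega>. 0 \<le> e1 n \<omega>" "\<And>n \<omega>. 0 \<le> e2 n \<omega>" "\<And>n \<omega>. 0 \<le> e3 n \<omega>"
      "\<And>n \<omega>. 0 \<le> d n \<omega>" "\<And>n \<omega>. 0 \<le> s n \<omega>"
    and a: "AE \<omega> in M. \<forall>n. 0 \<le> a n \<omega>" "AE \<omega> in M. summable (\<lambda>n. a n \<omega>)"
    and b: "AE \<omega> in M. \<forall>n. 0 \<le> b n \<omega>" "AE \<omega> in M. summable (\<lambda>n. b n \<omega>)"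
    and coeffs: "0 < k3" "0 < k4" "0 < k5" "0 < k6" "0 < k7" "0 < k8" "0 < k9"
    and pos: "\<And>n. 0 < l n" "\<And>n. 0 < g1 n" "\<And>n. 0 < g2 n"
    and divergent: "\<not> summable g1" "\<not> summable g2"
    and small: "\<And>n. k1 * l n \<le> k3 * g1 n" "\<And>n. k2 * l n \<le> k4 * g2 n"
      "\<And>n. k7 * (l n)\<^sup>2 + k8 * ((l n)\<^sup>2 / g1 n) + k9 * ((l n)\<^sup>2 / g2 n) \<le> k6 / 2 * l n"
    and rel1: "\<And>n. AE \<omega> in M. enn2ereal (nn_cond_exp M (G n) (\<lambda>\<omega>. ennreal (e1 (Suc n) \<omega>)) \<omega>)
      \<le> ereal (e1 n \<omega> + k1 * l n * e2 n \<omega> + k2 * l n * e3 n \<omega>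
          + a n \<omega> * (e1 n \<omega> + e2 n \<omega> + e3 n \<omega>) + b n \<omega>
          - k5 * l n * d n \<omega> - (k6 * l n - k7 * (l n)\<^sup>2) * s n \<omega>)"
    and rel2: "\<And>n. AE \<omega> in M. enn2ereal (nn_cond_exp M (G n) (\<lambda>\<omega>. ennreal (e2 (Suc n) \<omega>)) \<omega>)
      \<le> ereal ((1 - k3 * g1 n) * e2 n \<omega> + a n \<omega> * (e1 n \<omega> + e2 n \<omega> + e3 n \<omega>) + b n \<omega>
          + k8 * ((l n)\<^sup>2 / g1 n) * s n \<omega>)"
    and rel3: "\<And>n. AE \<omega> in M. enn2ereal (nn_cond_exp M (G n) (\<lambda>\<omega>. ennreal (e3 (Suc n) \<omega>)) \<omega>)
      \<le> ereal ((1 - k4 * g2 n) * e3 n \<omega> + a n \<omega> * (e1 n \<omega> + e2 n \<omega> + e3 n \<omega>) + b n \<omega>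
          + k9 * ((l n)\<^sup>2 / g2 n) * s n \<omega>)"
  shows "AE \<omega> in M. convergent (\<lambda>n. e1 n \<omega>) \<and> (\<lambda>n. e2 n \<omega>) \<longlonglongrightarrow> 0 \<and> (\<lambda>n. e3 n \<omega>) \<longlonglongrightarrow> 0 \<and>
    summable (\<lambda>n. l n * d n \<omega>)"
proof -
  define S where "S n \<omega> = e1 n \<omega> + e2 n \<omega> + e3 n \<omega>" for n \<omega>
  \<comment> \<open>Only half of the \<open>k6\<close> term remains; the other half covers the
    contributions with \<open>k7\<close>, \<open>k8\<close> and \<open>k9\<close>.\<close>
  define Z where "Z n \<omega> = k5 * l n * d n \<omega> + k6 / 2 * l n * s n \<omega>" for n \<omega>
  have S_nonneg: "0 \<le> S n \<omega>" for n \<omega> using nonneg by (simp add: S_def)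
  have l_nonneg: "0 \<le> l n" for n using pos(1)[of n] by simp
  have quot_nonneg: "0 \<le> (l n)\<^sup>2 / g1 n" "0 \<le> (l n)\<^sup>2 / g2 n" for n
    using pos(2,3)[of n] by simp_all
  have [measurable]: "e1 n \<in> borel_measurable M" "e2 n \<in> borel_measurable M"
      "e3 n \<in> borel_measurable M" for n
    using meas by (auto intro: measurable_G)
  \<comment> \<open>The factor 3 arises because each of the three rows contributes one copy of
    \<open>a n * S n\<close> and of \<open>b n\<close>.\<close>
  have relS: "AE \<omega> in M. enn2ereal (nn_cond_exp M (G n) (\<lambda>\<omega>. ennreal (S (Suc n) \<omega>)) \<omega>)
      \<le> ereal ((1 + 3 * a n \<omega>) * S n \<omega> + 3 * b n \<omega> - Z n \<omega>)" for n
  proof -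
    interpret sigma_finite_subalgebra M "G n" by (rule sigma_finite_subalgebra_G)
    let ?E = "\<lambda>f. nn_cond_exp M (G n) (\<lambda>\<omega>. ennreal (f (Suc n) \<omega>))"
    have split: "(\<lambda>\<omega>. ennreal (S (Suc n) \<omega>)) =
        (\<lambda>\<omega>. (ennreal (e1 (Suc n) \<omega>) + ennreal (e2 (Suc n) \<omega>)) + ennreal (e3 (Suc n) \<omega>))"
      using nonneg by (simp add: S_def)
    have "AE \<omega> in M. ?E e1 \<omega> + ?E e2 \<omega> =
        nn_cond_exp M (G n) (\<lambda>\<omega>. ennreal (e1 (Suc n) \<omega>) + ennreal (e2 (Suc n) \<omega>)) \<omega>"
      by (rule nn_cond_exp_sum) auto
    moreover have "AE \<omega> in M.
        nn_cond_exp M (G n) (\<lambda>\<omega>. ennreal (e1 (Suc n) \<omega>) + ennreal (e2 (Suc n) \<omega>)) \<omega> + ?E e3 \<omega> =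
        nn_cond_exp M (G n) (\<lambda>\<omega>. (ennreal (e1 (Suc n) \<omega>) + ennreal (e2 (Suc n) \<omega>)) + ennreal (e3 (Suc n) \<omega>)) \<omega>"
      by (rule nn_cond_exp_sum) auto
    ultimately have "AE \<omega> in M. ?E S \<omega> = ?E e1 \<omega> + ?E e2 \<omega> + ?E e3 \<omega>"
      by eventually_elim (simp only: split)
    with rel1[of n] rel2[of n] rel3[of n] show ?thesis
    proof eventually_elim
      case (elim \<omega>)
      \<comment> \<open>Naming the quotients makes the comparison \<open>le\<close>
        polynomial.\<close>
      define c1 c2 where c_def: "c1 = (l n)\<^sup>2 / g1 n" "c2 = (l n)\<^sup>2 / g2 n"
      have "k1 * l n * e2 n \<omega> \<le> k3 * g1 n * e2 n \<omega>" "k2 * l n * e3 n \<omega> \<le> k4 * g2 n * e3 n \<omega>"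
        using small nonneg by (auto intro: mult_right_mono)
      moreover from small(3) nonneg(5) have "(k7 * (l n)\<^sup>2 + k8 * ((l n)\<^sup>2 / g1 n) + k9 * ((l n)\<^sup>2 / g2 n)) * s n \<omega>
          \<le> k6 / 2 * l n * s n \<omega>"
        by (rule mult_right_mono)
      then have "(k7 * (l n)\<^sup>2 + k8 * c1 + k9 * c2) * s n \<omega> \<le> k6 / 2 * l n * s n \<omega>"
        by (simp add: c_def)
      ultimately have le: "(e1 n \<omega> + k1 * l n * e2 n \<omega> + k2 * l n * e3 n \<omega> + a n \<omega> * S n \<omega> + b n \<omega>
            - k5 * l n * d n \<omega> - (k6 * l n - k7 * (l n)\<^sup>2) * s n \<omega>)
          + ((1 - k3 * g1 n) * e2 n \<omega> + a n \<omega> * S n \<omega> + b n \<omega> + k8 * ((l n)\<^sup>2 / g1 n) * s n \<omega>)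
          + ((1 - k4 * g2 n) * e3 n \<omega> + a n \<omega> * S n \<omega> + b n \<omega> + k9 * ((l n)\<^sup>2 / g2 n) * s n \<omega>)
          \<le> (1 + 3 * a n \<omega>) * S n \<omega> + 3 * b n \<omega> - Z n \<omega>"
        unfolding S_def Z_def c_def[symmetric] by (simp add: algebra_simps)
      have "enn2ereal (?E S \<omega>) = enn2ereal (?E e1 \<omega>) + enn2ereal (?E e2 \<omega>) + enn2ereal (?E e3 \<omega>)"
        by (simp add: elim(4) plus_ennreal.rep_eq)
      also note add_mono[OF add_mono[OF elim(1,2)] elim(3)]
      finally show ?case
        using le unfolding S_def by (elim order_trans) simp
    qed
  qed
  have Z_meas: "Z n \<in> borel_measurable (G n)" for n
    unfolding Z_def using meas(4,5)[of n] by measurable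
  have S_meas: "S n \<in> borel_measurable (G n)" for n
    unfolding S_def using meas(1-3)[of n] by measurable
  have Z_nonneg: "0 \<le> Z n \<omega>" for n \<omega>
    unfolding Z_def using coeffs l_nonneg nonneg by (intro add_nonneg_nonneg mult_nonneg_nonneg) auto
  have conv: "AE \<omega> in M. convergent (\<lambda>n. S n \<omega>) \<and> summable (\<lambda>n. Z n \<omega>)"
  proof (rule robbins_siegmund[OF S_meas S_nonneg Z_meas Z_nonneg _ _ _ _ relS])
    show "AE \<omega> in M. \<forall>n. 0 \<le> 3 * a n \<omega>" "AE \<omega> in M. \<forall>n. 0 \<le> 3 * b n \<omega>"
      "AE \<omega> in M. summable (\<lambda>n. 3 * a n \<omega>)" "AE \<omega> in M. summable (\<lambda>n. 3 * b n \<omega>)"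
      using a b by (auto intro: summable_mult)
  qed
  have lds: "AE \<omega> in M. summable (\<lambda>n. l n * d n \<omega>) \<and> summable (\<lambda>n. k6 / 2 * l n * s n \<omega>)"
    using conv
  proof eventually_elim
    case (elim \<omega>)
    have "0 \<le> k5 * l n * d n \<omega>" "0 \<le> k6 / 2 * l n * s n \<omega>" for n
      using coeffs l_nonneg[of n] nonneg(4,5)[of n \<omega>] by auto
    then have "norm (k5 * l n * d n \<omega>) \<le> Z n \<omega>" "norm (k6 / 2 * l n * s n \<omega>) \<le> Z n \<omega>" for n
      by (simp_all add: Z_def)
    then have "summable (\<lambda>n. k5 * l n * d n \<omega>)" and s: "summable (\<lambda>n. k6 / 2 * l n * s n \<omega>)"
      using elim by (blast intro: summable_comparison_test')+
    from this(1) have "summable (\<lambda>n. k5 * l n * d n \<omega> / k5)" by (rule summable_divide)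
    with s show ?case using coeffs by simp
  qed
  \<comment> \<open>Treats rows two and three alike. Everything but the decay is a summable
    perturbation, because \<open>S\<close> is bounded along the path and \<open>q\<close> is
    dominated by \<open>k6 / 2 * l\<close>. Robbins--Siegmund gives convergence of \<open>e\<close>
    and of the series of \<open>g * e\<close>; divergence of the series of \<open>g\<close> forces
    the limit 0.\<close>
  have vanish: "AE \<omega> in M. (\<lambda>n. e n \<omega>) \<longlonglongrightarrow> 0"
    if e: "\<And>n. e n \<in> borel_measurable (G n)" "\<And>n \<omega>. 0 \<le> e n \<omega>"
      and g: "\<And>n. 0 < g n" "\<not> summable g" and k: "0 < k"
      and q: "\<And>n. 0 \<le> q n" "\<And>n. q n \<le> k6 / 2 * l n"
      and rel: "\<And>n. AE \<omega> in M. enn2ereal (nn_cond_exp M (G n) (\<lambda>\<omega>. ennreal (e (Suc n) \<omega>)) \<omega>)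
        \<le> ereal ((1 - k * g n) * e n \<omega> + a n \<omega> * S n \<omega> + b n \<omega> + q n * s n \<omega>)"
    for e :: "nat \<Rightarrow> 'a \<Rightarrow> real" and g q k
  proof -
    define b' where "b' n \<omega> = a n \<omega> * S n \<omega> + b n \<omega> + q n * s n \<omega>" for n \<omega>
    have "AE \<omega> in M. \<forall>n. 0 \<le> b' n \<omega>"
      using a(1) b(1) by eventually_elim (simp add: b'_def S_nonneg nonneg q)
    moreover have "AE \<omega> in M. summable (\<lambda>n. b' n \<omega>)"
      using a b(2) conv lds
    proof eventually_elim
      case (elim \<omega>)
      obtain B where B: "norm (S n \<omega>) \<le> B" for n
        using convergent_imp_Bseq[OF conjunct1[OF elim(4)]] unfolding Bseq_def by blast
      have "norm (a n \<omega> * S n \<omega>) \<le> a n \<omega> * B" for n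
        using elim(1) B[of n] by (simp add: abs_mult mult_left_mono)
      then have "summable (\<lambda>n. a n \<omega> * S n \<omega>)"
        using summable_mult2[OF elim(2)] by (rule summable_comparison_test'[rotated])
      moreover have "norm (q n * s n \<omega>) \<le> k6 / 2 * l n * s n \<omega>" for n
        using mult_right_mono[OF q(2) nonneg(5), of n n \<omega>] q(1)[of n] nonneg(5)[of n \<omega>]
        by (simp add: abs_mult)
      then have "summable (\<lambda>n. q n * s n \<omega>)"
        using conjunct2[OF elim(5)] by (rule summable_comparison_test'[rotated])
      ultimately show ?case unfolding b'_def using elim(3) by (intro summable_add)
    qed
    moreover have "AE \<omega> in M. enn2ereal (nn_cond_exp M (G n) (\<lambda>\<omega>. ennreal (e (Suc n) \<omega>)) \<omega>)
        \<le> ereal ((1 + 0) * e n \<omega> + b' n \<omega> - k * g n * e n \<omega>)" for n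
      using rel[of n] by (simp add: b'_def algebra_simps)
    moreover have "(\<lambda>\<omega>. k * g n * e n \<omega>) \<in> borel_measurable (G n)" for n
      using e(1)[of n] by measurable
    moreover have "0 \<le> k * g n * e n \<omega>" for n \<omega>
      using k g(1)[of n] e(2)[of n \<omega>] by simp
    \<comment> \<open>The multiplicative noise is 0 this time: the term \<open>a * S\<close>
      involves all three errors and has been moved into \<open>b'\<close>.\<close>
    ultimately have "AE \<omega> in M. convergent (\<lambda>n. e n \<omega>) \<and> summable (\<lambda>n. k * g n * e n \<omega>)"
      using e by (intro robbins_siegmund[where a = "\<lambda>_ _. 0" and b = b']) simp_all
    then show ?thesis
    proof eventually_elim
      case (elim \<omega>)
      have "summable (\<lambda>n. k * g n * e n \<omega> / k)" using elim by (intro summable_divide) simp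
      then have "summable (\<lambda>n. g n * e n \<omega>)" using k by simp
      then show ?case
        using elim e(2) g by (intro tendsto_zero_if_weighted_summable[of g]) (auto simp: less_imp_le)
    qed
  qed
  \<comment> \<open>All summands on the left of the third condition in \<open>small\<close> are
    nonnegative, so each of them alone obeys its bound.\<close>
  have bound: "k8 * ((l n)\<^sup>2 / g1 n) \<le> k6 / 2 * l n" "k9 * ((l n)\<^sup>2 / g2 n) \<le> k6 / 2 * l n"
      "0 \<le> k8 * ((l n)\<^sup>2 / g1 n)" "0 \<le> k9 * ((l n)\<^sup>2 / g2 n)" for n
  proof -
    have "0 \<le> k7 * (l n)\<^sup>2" using coeffs by simp
    moreover show "0 \<le> k8 * ((l n)\<^sup>2 / g1 n)" "0 \<le> k9 * ((l n)\<^sup>2 / g2 n)"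
      by (rule mult_nonneg_nonneg[OF less_imp_le quot_nonneg(1)] mult_nonneg_nonneg[OF less_imp_le quot_nonneg(2)]
          coeffs)+
    ultimately show "k8 * ((l n)\<^sup>2 / g1 n) \<le> k6 / 2 * l n" "k9 * ((l n)\<^sup>2 / g2 n) \<le> k6 / 2 * l n"
      using small(3)[of n] by linarith+
  qed
  have "AE \<omega> in M. (\<lambda>n. e2 n \<omega>) \<longlonglongrightarrow> 0"
    using vanish[OF meas(2) nonneg(2) pos(2) divergent(1) coeffs(1) bound(3,1)] rel2
    unfolding S_def by blast
  moreover have "AE \<omega> in M. (\<lambda>n. e3 n \<omega>) \<longlonglongrightarrow> 0"
    using vanish[OF meas(3) nonneg(3) pos(3) divergent(2) coeffs(2) bound(4,2)] rel3
    unfolding S_def by blast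
  ultimately show ?thesis using conv lds
  proof eventually_elim
    case (elim \<omega>)
    \<comment> \<open>The first error has no decay of its own; its convergence is inherited from the
      sum once the other two vanish.\<close>
    have "convergent (\<lambda>n. S n \<omega> - (e2 n \<omega> + e3 n \<omega>))"
      using elim by (intro convergent_diff convergent_add) (auto intro: convergentI)
    then show ?case using elim by (simp add: S_def)
  qed
qed

end

section \<open>The error recursion\<close>

text \<open>\<open>history\<close> is generated by single rows; this passes to the whole matrix,
  since every basis matrix is supported in one row.\<close>

lemma borel_measurable_rows:
  fixes X :: "'a \<Rightarrow> real^'d::finite^'m::finite"
  assumes "\<And>i. (\<lambda>\<omega>. X \<omega> $ i) \<in> borel_measurable N"
  shows "X \<in> borel_measurable N"
proof (subst borel_measurable_euclidean_space, rule ballI)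
  fix c :: "real^'d^'m"
  assume "c \<in> Basis"
  then obtain i b where "c = axis i b" by (auto simp: Basis_vec_def)
  then have "(\<lambda>\<omega>. X \<omega> \<bullet> c) = (\<lambda>\<omega>. X \<omega> $ i \<bullet> b)" by (simp add: inner_axis)
  then show "(\<lambda>\<omega>. X \<omega> \<bullet> c) \<in> borel_measurable N"
    using assms[of i] by simp
qed

lemma sets_history:
  "sets (history M x y k) = sigma_sets (space M)
     ({(\<lambda>\<omega>. x l \<omega> $ i) -` A \<inter> space M | l i A. l \<le> k \<and> A \<in> sets borel} \<union>
      {(\<lambda>\<omega>. y l \<omega> $ i) -` A \<inter> space M | l i A. l \<le> k \<and> A \<in> sets borel})"
  unfolding history_def by (rule sets_measure_of) auto

lemma space_history: "space (history M x y k) = space M"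
  by (simp add: history_def space_measure_of_conv)

lemma measurable_history:
  shows "x k \<in> borel_measurable (history M x y k)" "y k \<in> borel_measurable (history M x y k)"
  by (intro borel_measurable_rows measurableI;
      force simp: sets_history space_history intro!: sigma_sets.Basic)+

text \<open>The shift by \<open>N\<close> allows the recursion to start only where the relation
  holds and the stepsizes are small.\<close>

lemma filtered_prob_space_history:
  fixes x y :: "nat \<Rightarrow> 'w \<Rightarrow> real^'d::finite^'m::finite"
  assumes "prob_space M" "\<And>k. x k \<in> borel_measurable M" "\<And>k. y k \<in> borel_measurable M"
  shows "filtered_prob_space M (\<lambda>n. history M x y (n + N))"
proof -
  interpret prob_space M by (rule assms(1))
  show ?thesis
  proof
    fix n
    have nth: "(\<lambda>X :: real^'d^'m. X $ i) \<in> borel_measurable borel" for i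
      by (intro borel_measurable_continuous_onI continuous_intros)
    have meas: "(\<lambda>\<omega>. x l \<omega> $ i) \<in> borel_measurable M" "(\<lambda>\<omega>. y l \<omega> $ i) \<in> borel_measurable M" for l i
      by (rule measurable_compose[OF assms(2) nth] measurable_compose[OF assms(3) nth])+
    have "sets (history M x y (n + N)) \<subseteq> sets M"
      unfolding sets_history
      by (intro sets.sigma_sets_subset)
        (auto intro!: measurable_sets[OF meas(1)] measurable_sets[OF meas(2)])
    then show "subalgebra M (history M x y (n + N))"
      by (simp add: subalgebra_def space_history)
  next
    fix m n :: nat assume "m \<le> n"
    then have "l \<le> m + N \<Longrightarrow> l \<le> n + N" for l by simp
    then show "sets (history M x y (m + N)) \<subseteq> sets (history M x y (n + N))"
      unfolding sets_history by (intro sigma_sets_mono' Un_mono Collect_mono) blast+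
  qed
qed

lemma error_vec_nth:
  "error_vec F u v RW CW X Y $ 1 = F (weighted_avg u X) - (INF \<theta>. F \<theta>)"
  "error_vec F u v RW CW X Y $ 2 = (mnorm RW (X - rows_of (weighted_avg u X)))\<^sup>2"
  "error_vec F u v RW CW X Y $ 3 = (mnorm CW (Y - diag v ** rows_of (avg Y)))\<^sup>2"
  by (simp_all add: error_vec_def)

text \<open>Brings the matrix relation into the scalar form of
  \<open>coupled_robbins_siegmund\<close>. Subtracting the negative entries of \<open>H_mat\<close>
  produces the positive \<open>\<kappa> 8\<close> and \<open>\<kappa> 9\<close> terms.\<close>

lemma relation_rhs:
  fixes e :: "real^3" and \<kappa> :: "nat \<Rightarrow> real" and l g1 g2 b c p q :: real
  defines "r \<equiv> (V_mat \<kappa> l g1 g2 + c *\<^sub>R outer 1 1) *v e + b *\<^sub>R 1 - H_mat \<kappa> l g1 g2 *v vector [p, q]"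
  shows "r $ 1 = e $ 1 + \<kappa> 1 * l * e $ 2 + \<kappa> 2 * l * e $ 3 + c * (e $ 1 + e $ 2 + e $ 3) + b
      - \<kappa> 5 * l * p - (\<kappa> 6 * l - \<kappa> 7 * l\<^sup>2) * q"
    and "r $ 2 = (1 - \<kappa> 3 * g1) * e $ 2 + c * (e $ 1 + e $ 2 + e $ 3) + b + \<kappa> 8 * (l\<^sup>2 / g1) * q"
    and "r $ 3 = (1 - \<kappa> 4 * g2) * e $ 3 + c * (e $ 1 + e $ 2 + e $ 3) + b + \<kappa> 9 * (l\<^sup>2 / g2) * q"
  unfolding r_def
  by (simp_all add: matrix_vector_mult_def sum_3 sum_2 V_mat_def H_mat_def outer_def algebra_simps)

section \<open>Continuity of the error components, and asymptotics of the stepsizes\<close>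

lemma continuous_on_weighted_avg: "continuous_on S (weighted_avg u)"
  unfolding weighted_avg_def by (intro continuous_intros)

lemma continuous_on_avg: "continuous_on S avg"
  unfolding avg_def by (intro continuous_intros)

lemma continuous_on_rows_of:
  assumes "continuous_on S g"
  shows "continuous_on S (\<lambda>z. rows_of (g z))"
  unfolding rows_of_def using assms by (intro continuous_intros)

lemma continuous_on_diag_mult:
  assumes "continuous_on S g"
  shows "continuous_on S (\<lambda>z. diag v ** g z)"
  unfolding matrix_matrix_mult_def using assms by (intro continuous_intros)

lemma summable_square_tendsto_zero:
  fixes g :: "nat \<Rightarrow> real"
  assumes "summable (\<lambda>k. (g k)\<^sup>2)"
  shows "g \<longlonglongrightarrow> 0"
proof -
  have "(\<lambda>k. sqrt ((g k)\<^sup>2)) \<longlonglongrightarrow> sqrt 0"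
    using summable_LIMSEQ_zero[OF assms] by (rule tendsto_real_sqrt)
  then show ?thesis by (simp add: tendsto_rabs_zero_iff)
qed

text \<open>After division by \<open>l k\<close>, the left side of the third inequality consists of
  null sequences. That \<open>l\<close> itself tends to 0 follows by writing it as
  \<open>(l k / g1 k) * g1 k\<close>, with \<open>g1\<close> null by square summability.\<close>

lemma eventually_stepsizes_small:
  fixes l g1 g2 :: "nat \<Rightarrow> real" and k1 k2 k3 k4 k6 k7 k8 k9 :: real
  assumes pos: "\<And>k. 0 < l k" "\<And>k. 0 < g1 k" "\<And>k. 0 < g2 k"
    and coeffs: "0 < k1" "0 < k2" "0 < k3" "0 < k4" "0 < k6"
    and ratio: "(\<lambda>k. l k / g1 k) \<longlonglongrightarrow> 0" "(\<lambda>k. l k / g2 k) \<longlonglongrightarrow> 0"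
    and square: "summable (\<lambda>k. (g1 k)\<^sup>2)"
  shows "\<forall>\<^sub>F k in sequentially. k1 * l k \<le> k3 * g1 k \<and> k2 * l k \<le> k4 * g2 k \<and>
    k7 * (l k)\<^sup>2 + k8 * ((l k)\<^sup>2 / g1 k) + k9 * ((l k)\<^sup>2 / g2 k) \<le> k6 / 2 * l k"
proof -
  have "(\<lambda>k. (l k / g1 k) * g1 k) \<longlonglongrightarrow> 0 * 0"
    using ratio(1) summable_square_tendsto_zero[OF square] by (rule tendsto_mult)
  moreover have "(l k / g1 k) * g1 k = l k" for k using pos(2)[of k] by simp
  ultimately have l: "l \<longlonglongrightarrow> 0" by simp
  have "(\<lambda>k. k7 * l k + k8 * (l k / g1 k) + k9 * (l k / g2 k)) \<longlonglongrightarrow> k7 * 0 + k8 * 0 + k9 * 0"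
    using l ratio by (intro tendsto_intros)
  then have "\<forall>\<^sub>F k in sequentially. k7 * l k + k8 * (l k / g1 k) + k9 * (l k / g2 k) < k6 / 2"
    using coeffs by (intro order_tendstoD) auto
  moreover have "\<forall>\<^sub>F k in sequentially. l k / g1 k < k3 / k1"
    using ratio(1) coeffs by (intro order_tendstoD) auto
  moreover have "\<forall>\<^sub>F k in sequentially. l k / g2 k < k4 / k2"
    using ratio(2) coeffs by (intro order_tendstoD) auto
  ultimately show ?thesis
  proof eventually_elim
    case (elim k)
    have "(k7 * l k + k8 * (l k / g1 k) + k9 * (l k / g2 k)) * l k \<le> k6 / 2 * l k"
      using elim(1) pos(1)[of k] by (intro mult_right_mono) auto
    moreover have "k1 * l k \<le> k3 * g1 k" "k2 * l k \<le> k4 * g2 k"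
      using elim(2,3) pos[of k] coeffs by (simp_all add: field_simps)
    ultimately show ?case by (simp add: power2_eq_square algebra_simps)
  qed
qed

lemma liminf_zero_if_frequently_small:
  fixes s :: "nat \<Rightarrow> real"
  assumes "\<And>n. 0 \<le> s n" "\<And>e. 0 < e \<Longrightarrow> \<exists>\<^sub>F n in sequentially. s n < e"
  shows "liminf (\<lambda>n. ereal (s n)) = 0"
proof (rule order_antisym)
  show "liminf (\<lambda>n. ereal (s n)) \<le> 0"
  proof (rule ccontr)
    assume "\<not> ?thesis"
    then have "0 < liminf (\<lambda>n. ereal (s n))" by simp
    then obtain q where q: "0 < ereal (of_rat q)" "ereal (of_rat q) < liminf (\<lambda>n. ereal (s n))"
      using ereal_dense3 by blast
    then have "\<forall>\<^sub>F n in sequentially. ereal (of_rat q) < ereal (s n)" by (intro less_LiminfD)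
    moreover have "\<exists>\<^sub>F n in sequentially. s n < of_rat q" using q by (intro assms(2)) simp
    ultimately have "\<exists>\<^sub>F n in sequentially. ereal (of_rat q) < ereal (s n) \<and> s n < of_rat q"
      by (simp add: frequently_eventually_conj)
    then show False by (auto dest: frequently_ex)
  qed
  show "0 \<le> liminf (\<lambda>n. ereal (s n))" by (rule Liminf_bounded) (simp add: assms(1))
qed

section \<open>From the vector relation to almost sure convergence\<close>

theorem lemma10:
  fixes M :: "'w measure"
    and f :: "'m::finite \<Rightarrow> real^'d::finite \<Rightarrow> real" and F :: "real^'d \<Rightarrow> real"
    and R C RW CW :: "real^'m^'m" and u v :: "real^'m"
    and x y :: "nat \<Rightarrow> 'w \<Rightarrow> real^'d^'m"
    and a b :: "nat \<Rightarrow> 'w \<Rightarrow> real"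
    and lam \<gamma>1 \<gamma>2 \<alpha> \<kappa> :: "nat \<Rightarrow> real"
    and L :: real and T :: nat
  assumes prob: "prob_space M"
    and F_def: "\<forall>\<theta>. F \<theta> = (1 / real CARD('m)) * (\<Sum>i\<in>UNIV. f i \<theta>)"
    and F_convex: "convex_on UNIV F"
    and F_diff: "\<forall>\<theta>. F differentiable (at \<theta>)"
    and F_min: "\<exists>\<theta>. \<forall>\<theta>'. F \<theta> \<le> F \<theta>'"
    and f_diff: "\<forall>i \<theta>. f i differentiable (at \<theta>)"
    and L_pos: "L > 0"
    and f_lipschitz: "\<forall>i w z. norm (grad (f i) w - grad (f i) z) \<le> L * norm (w - z)"
    and R_offdiag: "\<forall>i j. i \<noteq> j \<longrightarrow> 0 \<le> R $ i $ j"
    and C_offdiag: "\<forall>i j. i \<noteq> j \<longrightarrow> 0 \<le> C $ i $ j"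
    and R_rows: "R *v 1 = 0"
    and C_cols: "1 v* C = 0"
    and common_root: "\<exists>r. (\<exists>S. spanning_tree (digraph R) r S) \<and>
                          (\<exists>S. spanning_tree (digraph (transpose C)) r S)"
    and u: "\<forall>i. 0 \<le> u $ i" "u v* R = 0" "u \<bullet> 1 = real CARD('m)"
    and v: "\<forall>i. 0 \<le> v $ i" "C *v v = 0" "1 \<bullet> v = real CARD('m)"
    and RW: "invertible RW"
      "\<forall>\<^sub>F k in sequentially.
         induced_norm RW (mat 1 + \<gamma>1 k *\<^sub>R R - (1 / real CARD('m)) *\<^sub>R outer 1 u) < 1"
    and CW: "invertible CW"
      "\<forall>\<^sub>F k in sequentially.
         induced_norm CW ((1 - \<alpha> k) *\<^sub>R (mat 1 - (1 / real CARD('m)) *\<^sub>R outer v 1) + \<gamma>2 k *\<^sub>R C) < 1"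
    and x_meas: "\<forall>k. x k \<in> borel_measurable M"
    and y_meas: "\<forall>k. y k \<in> borel_measurable M"
    and a_meas: "\<forall>k. a k \<in> borel_measurable M"
    and b_meas: "\<forall>k. b k \<in> borel_measurable M"
    and a: "AE \<omega> in M. \<forall>k. 0 \<le> a k \<omega>" "AE \<omega> in M. summable (\<lambda>k. a k \<omega>)"
    and b: "AE \<omega> in M. \<forall>k. 0 \<le> b k \<omega>" "AE \<omega> in M. summable (\<lambda>k. b k \<omega>)"
    and \<kappa>: "\<forall>i\<in>{1..9}. \<kappa> i > 0" "\<kappa> 3 < 1" "\<kappa> 4 < 1"
    and pos: "\<forall>k. lam k > 0" "\<forall>k. \<gamma>1 k > 0" "\<forall>k. \<gamma>2 k > 0"
    and lam_sum: "LIM n sequentially. (\<Sum>k<n. lam k) :> at_top"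
    and \<gamma>_sum: "LIM n sequentially. (\<Sum>k<n. \<gamma>1 k) :> at_top"
                "LIM n sequentially. (\<Sum>k<n. \<gamma>2 k) :> at_top"
    and \<gamma>_square: "summable (\<lambda>k. (\<gamma>1 k)\<^sup>2)" "summable (\<lambda>k. (\<gamma>2 k)\<^sup>2)"
    and lam_\<gamma>_sum: "summable (\<lambda>k. (lam k)\<^sup>2 / \<gamma>1 k)" "summable (\<lambda>k. (lam k)\<^sup>2 / \<gamma>2 k)"
    and lam_\<gamma>_lim: "(\<lambda>k. lam k / \<gamma>1 k) \<longlonglongrightarrow> 0" "(\<lambda>k. lam k / \<gamma>2 k) \<longlonglongrightarrow> 0"
    and \<gamma>_ratio: "convergent (\<lambda>k. \<gamma>1 k / \<gamma>2 k)"
    \<comment> \<open>the conditional expectation is that of a nonnegative function and may be infinite;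
        the right-hand side may a priori be negative, hence the comparison in ereal\<close>
    and relation: "\<forall>k\<ge>T. AE \<omega> in M. \<forall>j.
       enn2ereal (nn_cond_exp M (history M x y k)
         (\<lambda>\<omega>'. ennreal (error_vec F u v RW CW (x (Suc k) \<omega>') (y (Suc k) \<omega>') $ j)) \<omega>)
       \<le> ereal (((V_mat \<kappa> (lam k) (\<gamma>1 k) (\<gamma>2 k) + a k \<omega> *\<^sub>R outer 1 1)
                    *v error_vec F u v RW CW (x k \<omega>) (y k \<omega>)
                  + b k \<omega> *\<^sub>R 1
                  - H_mat \<kappa> (lam k) (\<gamma>1 k) (\<gamma>2 k)
                    *v vector [(norm (grad F (weighted_avg u (x k \<omega>))))\<^sup>2,
                               (norm (avg (y k \<omega>)))\<^sup>2]) $ j)"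
  shows
    "(AE \<omega> in M. convergent (\<lambda>k. F (weighted_avg u (x k \<omega>)))) \<and>
     (AE \<omega> in M. \<forall>i.
        (\<lambda>k. norm (x k \<omega> $ i - weighted_avg u (x k \<omega>))) \<longlonglongrightarrow> 0 \<and>
        (\<lambda>k. norm (y k \<omega> $ i - v $ i *\<^sub>R avg (y k \<omega>))) \<longlonglongrightarrow> 0) \<and>
     (AE \<omega> in M. liminf (\<lambda>k. ereal (norm (grad F (weighted_avg u (x k \<omega>))))) = 0) \<and>
     ((\<forall>c. bounded {\<theta>. F \<theta> \<le> c}) \<longrightarrow>
        (AE \<omega> in M.
           bounded (range (\<lambda>k. weighted_avg u (x k \<omega>))) \<and>
           (\<forall>p. (\<exists>s. strict_mono s \<and> (\<lambda>k. weighted_avg u (x (s k) \<omega>)) \<longlonglongrightarrow> p) \<longrightarrow>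
                (\<forall>\<theta>. F p \<le> F \<theta>))) \<and>
        (AE \<omega> in M. \<forall>i. (\<lambda>k. F (x k \<omega> $ i)) \<longlonglongrightarrow> (INF \<theta>. F \<theta>)))"
proof -
  let ?xb = "\<lambda>k \<omega>. weighted_avg u (x k \<omega>)"
  obtain \<theta>\<^sub>0 where \<theta>\<^sub>0: "F \<theta>\<^sub>0 \<le> F \<theta>" for \<theta> using F_min by blast
  have F_bdd: "bdd_below (range F)" using \<theta>\<^sub>0 by (intro bdd_belowI[of _ "F \<theta>\<^sub>0"]) auto
  then have INF_le: "(INF \<theta>. F \<theta>) \<le> F \<theta>" for \<theta> by (rule cINF_lower) simp
  \<comment> \<open>The infimum inside \<open>error_vec\<close> is attained, so it can be exchanged
    for the value at a minimiser.\<close>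
  have INF_eq: "(INF \<theta>. F \<theta>) = F \<theta>\<^sub>0"
    using \<theta>\<^sub>0 INF_le by (intro order_antisym cINF_greatest) auto
  have F_cont: "continuous_on UNIV F"
    using F_diff by (simp add: continuous_at_imp_continuous_on differentiable_imp_continuous_within)
  have grad_cont: "continuous_on UNIV (grad F)"
  proof -
    have "F = (\<lambda>\<theta>. 1 / real CARD('m) * (\<Sum>i\<in>UNIV. f i \<theta>))" using F_def by (intro ext) simp
    then have "grad F = (\<lambda>\<theta>. (1 / real CARD('m)) *\<^sub>R (\<Sum>i\<in>UNIV. grad (f i) \<theta>))"
      using f_diff by (intro ext) (simp only: grad_mean)
    moreover have "continuous_on UNIV (grad (f i))" for i
      by (rule lipschitz_on_continuous_on[of L], rule lipschitz_onI)
        (use f_lipschitz L_pos in \<open>auto simp: dist_norm\<close>)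
    ultimately show ?thesis by (simp only:) (intro continuous_intros)
  qed
  have \<kappa>_pos: "0 < \<kappa> 1" "0 < \<kappa> 2" "0 < \<kappa> 3" "0 < \<kappa> 4" "0 < \<kappa> 5" "0 < \<kappa> 6" "0 < \<kappa> 7" "0 < \<kappa> 8" "0 < \<kappa> 9"
    using \<kappa>(1) by auto
  have "\<forall>\<^sub>F k in sequentially. \<kappa> 1 * lam k \<le> \<kappa> 3 * \<gamma>1 k \<and> \<kappa> 2 * lam k \<le> \<kappa> 4 * \<gamma>2 k \<and>
      \<kappa> 7 * (lam k)\<^sup>2 + \<kappa> 8 * ((lam k)\<^sup>2 / \<gamma>1 k) + \<kappa> 9 * ((lam k)\<^sup>2 / \<gamma>2 k) \<le> \<kappa> 6 / 2 * lam k"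
    using pos \<kappa>_pos lam_\<gamma>_lim \<gamma>_square(1) by (intro eventually_stepsizes_small) auto
  then obtain T\<^sub>1 where T\<^sub>1: "\<And>k. T\<^sub>1 \<le> k \<Longrightarrow> \<kappa> 1 * lam k \<le> \<kappa> 3 * \<gamma>1 k \<and> \<kappa> 2 * lam k \<le> \<kappa> 4 * \<gamma>2 k \<and>
      \<kappa> 7 * (lam k)\<^sup>2 + \<kappa> 8 * ((lam k)\<^sup>2 / \<gamma>1 k) + \<kappa> 9 * ((lam k)\<^sup>2 / \<gamma>2 k) \<le> \<kappa> 6 / 2 * lam k"
    unfolding eventually_sequentially by blast
  \<comment> \<open>From \<open>N\<close> on, both the relation and the smallness of the stepsizes
    are available.\<close>
  define N where "N = max T T\<^sub>1"
  interpret filtered_prob_space M "\<lambda>n. history M x y (n + N)"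
    using prob x_meas y_meas by (intro filtered_prob_space_history) auto
  define e where "e n \<omega> = error_vec F u v RW CW (x (n + N) \<omega>) (y (n + N) \<omega>)" for n \<omega>
  define d where "d k \<omega> = (norm (grad F (?xb k \<omega>)))\<^sup>2" for k \<omega>
  define s where "s k \<omega> = (norm (avg (y k \<omega>)))\<^sup>2" for k \<omega>
  \<comment> \<open>All error terms are continuous functions of the current iterates, hence adapted
    to the history.\<close>
  have cont_meas: "(\<lambda>\<omega>. \<phi> (x (n + N) \<omega>)) \<in> borel_measurable (history M x y (n + N))"
      "(\<lambda>\<omega>. \<phi> (y (n + N) \<omega>)) \<in> borel_measurable (history M x y (n + N))"
    if "continuous_on UNIV \<phi>" for \<phi> :: "real^'d^'m \<Rightarrow> real" and n
    by (rule borel_measurable_continuous_on[OF that] measurable_history)+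
  have avg_cont: "continuous_on UNIV (\<lambda>X. \<psi> (weighted_avg u X))" if "continuous_on UNIV \<psi>"
    for \<psi> :: "real^'d \<Rightarrow> 'b::topological_space"
    using that continuous_on_weighted_avg by (rule continuous_on_compose2) simp
  have rel: "AE \<omega> in M. \<forall>j. enn2ereal (nn_cond_exp M (history M x y (n + N))
        (\<lambda>\<omega>'. ennreal (e (Suc n) \<omega>' $ j)) \<omega>)
      \<le> ereal (((V_mat \<kappa> (lam (n + N)) (\<gamma>1 (n + N)) (\<gamma>2 (n + N)) + a (n + N) \<omega> *\<^sub>R outer 1 1) *v e n \<omega>
          + b (n + N) \<omega> *\<^sub>R 1 - H_mat \<kappa> (lam (n + N)) (\<gamma>1 (n + N)) (\<gamma>2 (n + N))
            *v vector [d (n + N) \<omega>, s (n + N) \<omega>]) $ j)" for n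
    using relation[rule_format, of "n + N"] by (simp add: e_def d_def s_def N_def)
  have main: "AE \<omega> in M. convergent (\<lambda>n. e n \<omega> $ 1) \<and> (\<lambda>n. e n \<omega> $ 2) \<longlonglongrightarrow> 0 \<and>
      (\<lambda>n. e n \<omega> $ 3) \<longlonglongrightarrow> 0 \<and> summable (\<lambda>n. lam (n + N) * d (n + N) \<omega>)"
  proof (rule coupled_robbins_siegmund[where s = "\<lambda>n. s (n + N)" and a = "\<lambda>n. a (n + N)"
        and b = "\<lambda>n. b (n + N)" and ?g1.0 = "\<lambda>n. \<gamma>1 (n + N)" and ?g2.0 = "\<lambda>n. \<gamma>2 (n + N)"
        and ?k1.0 = "\<kappa> 1" and ?k2.0 = "\<kappa> 2" and ?k3.0 = "\<kappa> 3" and ?k4.0 = "\<kappa> 4" and ?k5.0 = "\<kappa> 5"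
        and ?k6.0 = "\<kappa> 6" and ?k7.0 = "\<kappa> 7" and ?k8.0 = "\<kappa> 8" and ?k9.0 = "\<kappa> 9"])
    fix n
    show "(\<lambda>\<omega>. e n \<omega> $ 1) \<in> borel_measurable (history M x y (n + N))"
      unfolding e_def error_vec_nth
      by (intro borel_measurable_diff borel_measurable_const cont_meas(1) avg_cont F_cont)
    show "(\<lambda>\<omega>. e n \<omega> $ 2) \<in> borel_measurable (history M x y (n + N))"
      unfolding e_def error_vec_nth
      by (intro cont_meas(1) continuous_on_power continuous_on_mnorm continuous_on_diff
          continuous_on_rows_of continuous_on_weighted_avg continuous_on_id)
    show "(\<lambda>\<omega>. e n \<omega> $ 3) \<in> borel_measurable (history M x y (n + N))"
      unfolding e_def error_vec_nth
      by (intro cont_meas(2) continuous_on_power continuous_on_mnorm continuous_on_diff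
          continuous_on_diag_mult continuous_on_rows_of continuous_on_avg continuous_on_id)
    show "d (n + N) \<in> borel_measurable (history M x y (n + N))"
      unfolding d_def
      by (intro cont_meas(1) continuous_on_power continuous_on_norm avg_cont grad_cont)
    show "s (n + N) \<in> borel_measurable (history M x y (n + N))"
      unfolding s_def
      by (intro cont_meas(2) continuous_on_power continuous_on_norm continuous_on_avg)
    show "0 \<le> e n \<omega> $ 1" "0 \<le> e n \<omega> $ 2" "0 \<le> e n \<omega> $ 3" "0 \<le> d (n + N) \<omega>" "0 \<le> s (n + N) \<omega>" for \<omega>
      using INF_le by (simp_all add: e_def d_def s_def error_vec_nth)
    show "0 < lam (n + N)" "0 < \<gamma>1 (n + N)" "0 < \<gamma>2 (n + N)" using pos by auto
    show "\<kappa> 1 * lam (n + N) \<le> \<kappa> 3 * \<gamma>1 (n + N)" "\<kappa> 2 * lam (n + N) \<le> \<kappa> 4 * \<gamma>2 (n + N)"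
      "\<kappa> 7 * (lam (n + N))\<^sup>2 + \<kappa> 8 * ((lam (n + N))\<^sup>2 / \<gamma>1 (n + N)) +
        \<kappa> 9 * ((lam (n + N))\<^sup>2 / \<gamma>2 (n + N)) \<le> \<kappa> 6 / 2 * lam (n + N)"
      using T\<^sub>1[of "n + N"] by (auto simp: N_def)
    from rel[of n] show "AE \<omega> in M. enn2ereal (nn_cond_exp M (history M x y (n + N))
          (\<lambda>\<omega>. ennreal (e (Suc n) \<omega> $ 1)) \<omega>)
        \<le> ereal (e n \<omega> $ 1 + \<kappa> 1 * lam (n + N) * e n \<omega> $ 2 + \<kappa> 2 * lam (n + N) * e n \<omega> $ 3
          + a (n + N) \<omega> * (e n \<omega> $ 1 + e n \<omega> $ 2 + e n \<omega> $ 3) + b (n + N) \<omega>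
          - \<kappa> 5 * lam (n + N) * d (n + N) \<omega>
          - (\<kappa> 6 * lam (n + N) - \<kappa> 7 * (lam (n + N))\<^sup>2) * s (n + N) \<omega>)"
      by eventually_elim (simp only: forall_3 relation_rhs)
    from rel[of n] show "AE \<omega> in M. enn2ereal (nn_cond_exp M (history M x y (n + N))
          (\<lambda>\<omega>. ennreal (e (Suc n) \<omega> $ 2)) \<omega>)
        \<le> ereal ((1 - \<kappa> 3 * \<gamma>1 (n + N)) * e n \<omega> $ 2
          + a (n + N) \<omega> * (e n \<omega> $ 1 + e n \<omega> $ 2 + e n \<omega> $ 3) + b (n + N) \<omega>
          + \<kappa> 8 * ((lam (n + N))\<^sup>2 / \<gamma>1 (n + N)) * s (n + N) \<omega>)"
      by eventually_elim (simp only: forall_3 relation_rhs)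
    from rel[of n] show "AE \<omega> in M. enn2ereal (nn_cond_exp M (history M x y (n + N))
          (\<lambda>\<omega>. ennreal (e (Suc n) \<omega> $ 3)) \<omega>)
        \<le> ereal ((1 - \<kappa> 4 * \<gamma>2 (n + N)) * e n \<omega> $ 3
          + a (n + N) \<omega> * (e n \<omega> $ 1 + e n \<omega> $ 2 + e n \<omega> $ 3) + b (n + N) \<omega>
          + \<kappa> 9 * ((lam (n + N))\<^sup>2 / \<gamma>2 (n + N)) * s (n + N) \<omega>)"
      by eventually_elim (simp only: forall_3 relation_rhs)
  next
    show "AE \<omega> in M. \<forall>n. 0 \<le> a (n + N) \<omega>" using a(1) by eventually_elim simp
    show "AE \<omega> in M. \<forall>n. 0 \<le> b (n + N) \<omega>" using b(1) by eventually_elim simp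
    show "AE \<omega> in M. summable (\<lambda>n. a (n + N) \<omega>)" using a(2) by eventually_elim (rule summable_ignore_initial_segment)
    show "AE \<omega> in M. summable (\<lambda>n. b (n + N) \<omega>)" using b(2) by eventually_elim (rule summable_ignore_initial_segment)
    show "\<not> summable (\<lambda>n. \<gamma>1 (n + N))" "\<not> summable (\<lambda>n. \<gamma>2 (n + N))"
      using \<gamma>_sum[THEN not_summable_if_sums_at_top] by (simp_all add: summable_iff_shift)
  qed (use \<kappa>_pos in auto)
  \<comment> \<open>From here on the argument is deterministic: \<omega> is a fixed path on which
    the conclusion of \<open>main\<close> holds.\<close>
  have path: "convergent (\<lambda>k. F (?xb k \<omega>)) \<and>
      (\<forall>i. (\<lambda>k. x k \<omega> $ i - ?xb k \<omega>) \<longlonglongrightarrow> 0 \<and> (\<lambda>k. y k \<omega> $ i - v $ i *\<^sub>R avg (y k \<omega>)) \<longlonglongrightarrow> 0) \<and>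
      (\<forall>r>0. \<exists>\<^sub>F k in sequentially. norm (grad F (?xb k \<omega>)) < r)"
    if lim: "convergent (\<lambda>n. e n \<omega> $ 1) \<and> (\<lambda>n. e n \<omega> $ 2) \<longlonglongrightarrow> 0 \<and>
      (\<lambda>n. e n \<omega> $ 3) \<longlonglongrightarrow> 0 \<and> summable (\<lambda>n. lam (n + N) * d (n + N) \<omega>)" for \<omega>
  proof (intro conjI allI impI)
    have "convergent (\<lambda>n. e n \<omega> $ 1 + (INF \<theta>. F \<theta>))"
      using lim by (intro convergent_add) (auto intro: convergent_const)
    then have "convergent (\<lambda>n. F (?xb (n + N) \<omega>))" by (simp add: e_def error_vec_nth)
    then show "convergent (\<lambda>k. F (?xb k \<omega>))"
      by (simp only: convergent_ignore_initial_segment[where f = "\<lambda>k. F (?xb k \<omega>)"])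
    fix i
    have "(\<lambda>n. (mnorm RW (x n \<omega> - rows_of (?xb n \<omega>)))\<^sup>2) \<longlonglongrightarrow> 0"
      by (rule LIMSEQ_offset[where k = N]) (use lim in \<open>simp add: e_def error_vec_nth\<close>)
    from tendsto_rows_if_mnorm[OF RW(1) this, of i]
    show "(\<lambda>k. x k \<omega> $ i - ?xb k \<omega>) \<longlonglongrightarrow> 0" by (simp add: rows_of_def)
    have "(\<lambda>n. (mnorm CW (y n \<omega> - diag v ** rows_of (avg (y n \<omega>))))\<^sup>2) \<longlonglongrightarrow> 0"
      by (rule LIMSEQ_offset[where k = N]) (use lim in \<open>simp add: e_def error_vec_nth\<close>)
    from tendsto_rows_if_mnorm[OF CW(1) this, of i]
    show "(\<lambda>k. y k \<omega> $ i - v $ i *\<^sub>R avg (y k \<omega>)) \<longlonglongrightarrow> 0" by (simp only: row_deviation_avg)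
  next
    fix r :: real assume r: "0 < r"
    have "summable (\<lambda>n. lam n * d n \<omega>)"
      using lim summable_iff_shift[of "\<lambda>n. lam n * d n \<omega>" N] by blast
    \<comment> \<open>\<open>d\<close> is the squared gradient norm, hence the threshold
      \<open>r\<^sup>2\<close>.\<close>
    then have "\<exists>\<^sub>F k in sequentially. d k \<omega> < r\<^sup>2"
      using pos(1) r not_summable_if_sums_at_top[OF lam_sum]
      by (intro frequently_less_if_weighted_summable[of lam]) (auto simp: less_imp_le)
    then show "\<exists>\<^sub>F k in sequentially. norm (grad F (?xb k \<omega>)) < r"
      by (rule frequently_elim1) (use r in \<open>auto simp: d_def intro: power_less_imp_less_base\<close>)
  qed
  have levels: "(bounded (range (\<lambda>k. ?xb k \<omega>)) \<and>
       (\<forall>p. (\<exists>s. strict_mono s \<and> (\<lambda>k. ?xb (s k) \<omega>) \<longlonglongrightarrow> p) \<longrightarrow> (\<forall>\<theta>. F p \<le> F \<theta>))) \<and>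
     (\<forall>i. (\<lambda>k. F (x k \<omega> $ i)) \<longlonglongrightarrow> (INF \<theta>. F \<theta>))"
    if bdd: "\<forall>c. bounded {\<theta>. F \<theta> \<le> c}"
      and p: "convergent (\<lambda>k. F (?xb k \<omega>)) \<and>
      (\<forall>i. (\<lambda>k. x k \<omega> $ i - ?xb k \<omega>) \<longlonglongrightarrow> 0 \<and> (\<lambda>k. y k \<omega> $ i - v $ i *\<^sub>R avg (y k \<omega>)) \<longlonglongrightarrow> 0) \<and>
      (\<forall>r>0. \<exists>\<^sub>F k in sequentially. norm (grad F (?xb k \<omega>)) < r)" for \<omega>
  proof -
    note lv = convex_bounded_levels_convergence[of F \<theta>\<^sub>0 "\<lambda>k. ?xb k \<omega>"]
    have bounded: "bounded (range (\<lambda>k. ?xb k \<omega>))"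
      using F_convex F_diff grad_cont \<theta>\<^sub>0 bdd p by (intro lv(1)) auto
    have lim: "(\<lambda>k. F (?xb k \<omega>)) \<longlonglongrightarrow> F \<theta>\<^sub>0"
      using F_convex F_diff grad_cont \<theta>\<^sub>0 bdd p by (intro lv(2)) auto
    \<comment> \<open>Along a subsequence converging to \<open>q\<close>, the values tend to
      \<open>F q\<close> by continuity and to the minimum by \<open>lim\<close>.\<close>
    have "F q \<le> F \<theta>" if "strict_mono s" "(\<lambda>k. ?xb (s k) \<omega>) \<longlonglongrightarrow> q" for q s \<theta>
    proof -
      have "(\<lambda>k. F (?xb (s k) \<omega>)) \<longlonglongrightarrow> F q"
        using F_cont that(2) by (rule continuous_on_tendsto_compose) auto
      moreover have "(\<lambda>k. F (?xb (s k) \<omega>)) \<longlonglongrightarrow> F \<theta>\<^sub>0"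
        using LIMSEQ_subseq_LIMSEQ[OF lim that(1)] by (simp add: o_def)
      ultimately have "F q = F \<theta>\<^sub>0" by (rule LIMSEQ_unique)
      with \<theta>\<^sub>0 show ?thesis by simp
    qed
    moreover have "(\<lambda>k. F (x k \<omega> $ i)) \<longlonglongrightarrow> (INF \<theta>. F \<theta>)" for i
    proof -
      have "(\<lambda>k. x k \<omega> $ i - ?xb k \<omega>) \<longlonglongrightarrow> 0" using p by blast
      then show ?thesis
        unfolding INF_eq using lim
        by (rule continuous_bounded_asymptotic[of F "\<lambda>k. ?xb k \<omega>" "\<lambda>k. x k \<omega> $ i", OF F_cont bounded])
    qed
    ultimately show ?thesis using bounded by blast
  qed
  show ?thesis
  proof (intro conjI impI)
    show "AE \<omega> in M. convergent (\<lambda>k. F (?xb k \<omega>))"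
      using main by eventually_elim (use path in blast)
    show "AE \<omega> in M. \<forall>i. (\<lambda>k. norm (x k \<omega> $ i - ?xb k \<omega>)) \<longlonglongrightarrow> 0 \<and>
        (\<lambda>k. norm (y k \<omega> $ i - v $ i *\<^sub>R avg (y k \<omega>))) \<longlonglongrightarrow> 0"
      using main by eventually_elim (intro allI conjI tendsto_norm_zero; use path in blast)
    show "AE \<omega> in M. liminf (\<lambda>k. ereal (norm (grad F (?xb k \<omega>)))) = 0"
      using main by eventually_elim (intro liminf_zero_if_frequently_small norm_ge_zero; use path in blast)
    assume bdd: "\<forall>c. bounded {\<theta>. F \<theta> \<le> c}"
    show "AE \<omega> in M. bounded (range (\<lambda>k. ?xb k \<omega>)) \<and>
       (\<forall>p. (\<exists>s. strict_mono s \<and> (\<lambda>k. ?xb (s k) \<omega>) \<longlonglongrightarrow> p) \<longrightarrow> (\<forall>\<theta>. F p \<le> F \<theta>))"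
      using main by eventually_elim (rule levels[OF bdd path, THEN conjunct1])
    show "AE \<omega> in M. \<forall>i. (\<lambda>k. F (x k \<omega> $ i)) \<longlonglongrightarrow> (INF \<theta>. F \<theta>)"
      using main by eventually_elim (rule levels[OF bdd path, THEN conjunct2])
  qed
qed

end
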